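(* Let $T>0$, $\Delta f = 1/T$, $0\le \tau_0<T$ and $0\le \nu_0<\Delta f$. The time-domain signal $p_{(\tau_0,\nu_0)}(t)$ whose ZAK representation is $$\mathcal{Z}_{(p,\tau_0,\nu_0)}(\tau,\nu)=\sum_{m=-\infty}^{\infty}\sum_{n=-\infty}^{\infty} e^{j2\pi\nu_0 nT}\,\delta(\tau-\tau_0-nT)\,\delta(\nu-\nu_0-m\Delta f)$$ is given by $$p_{(\tau_0,\nu_0)}(t)=\sqrt{T}\sum_{n=-\infty}^{\infty}e^{j2\pi\nu_0 nT}\,\delta(t-\tau_0-nT).$$
   Context: Here $j=\sqrt{-1}$ and $\delta$ is the Dirac delta. For a complex time-domain signal $x(t)$, $t\in\mathbb{R}$, and fixed $T>0$, the ZAK representation of $x$ is the two-dimensional signal $$\mathcal{Z}_x(\tau,\nu)=\sqrt{T}\sum_{n=-\infty}^{\infty}x(\tau+nT)\,e^{-j2\pi n\nu T},\qquad \tau,\nu\in\mathbb{R}.$$ Since the signals in this statement are impulse trains, "signal" means tempered distribution: the time-domain signal $p$ is a tempered distribution on $\mathbb{R}$, and its ZAK representation is the tempered distribution on $\mathbb{R}^2$ given by the series $\sqrt{T}\sum_{n=-\infty}^{\infty}p(\tau+nT)\,e^{-j2\pi n\nu T}$, where the $n$-th term of the sum is the tensor product of the translate $p(\cdot+nT)$ (in $\tau$) with the function $e^{-j2\pi n\nu T}$ (in $\nu$), the series converging in the sense of tempered distributions. *)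

theory Defs
  imports "HOL-Analysis.Analysis"
begin

section \<open>Schwartz functions\<close>

definition partial_deriv ::
    "'a::euclidean_space \<Rightarrow> ('a \<Rightarrow> complex) \<Rightarrow> 'a \<Rightarrow> complex" where
  "partial_deriv b f = (\<lambda>x. frechet_derivative f (at x) b)"

abbreviation partial_derivs ::
    "'a::euclidean_space list \<Rightarrow> ('a \<Rightarrow> complex) \<Rightarrow> 'a \<Rightarrow> complex" where
  "partial_derivs bs f \<equiv> foldr partial_deriv bs f"

text \<open>Lists over \<open>Basis\<close> play the role of multi-indices. The first condition is
  smoothness: \<^const>\<open>differentiable\<close> is Frechet differentiability, so every iterated
  partial derivative is in particular continuous.\<close>

definition schwartz :: "('a::euclidean_space \<Rightarrow> complex) set" where
  "schwartz = {f.
     (\<forall>bs\<in>lists Basis. \<forall>x. partial_derivs bs f differentiable at x) \<and>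
     (\<forall>k::nat. \<forall>bs\<in>lists Basis. bounded (range (\<lambda>x. norm x ^ k *\<^sub>R partial_derivs bs f x)))}"

definition schwartz_tendsto ::
    "(nat \<Rightarrow> 'a::euclidean_space \<Rightarrow> complex) \<Rightarrow> ('a \<Rightarrow> complex) \<Rightarrow> bool" where
  "schwartz_tendsto F f \<longleftrightarrow>
     (\<forall>k::nat. \<forall>bs\<in>lists Basis.
        uniform_limit UNIV (\<lambda>i x. norm x ^ k *\<^sub>R partial_derivs bs (F i) x)
          (\<lambda>x. norm x ^ k *\<^sub>R partial_derivs bs f x) sequentially)"


section \<open>Tempered distributions\<close>

text \<open>A distribution is represented by a functional on all functions, of which only the
  values on \<^const>\<open>schwartz\<close> matter; two functionals denote the same distribution
  iff they satisfy \<open>dist_eq\<close>.\<close>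

type_synonym 'a functional = "('a \<Rightarrow> complex) \<Rightarrow> complex"

definition dist_eq :: "'a::euclidean_space functional \<Rightarrow> 'a functional \<Rightarrow> bool" where
  "dist_eq u v \<longleftrightarrow> (\<forall>\<phi>\<in>schwartz. u \<phi> = v \<phi>)"

text \<open>The Schwartz space is metrizable, so continuity is sequential continuity.\<close>

definition tempered_distribution :: "'a::euclidean_space functional \<Rightarrow> bool" where
  "tempered_distribution u \<longleftrightarrow>
     (\<forall>\<phi>\<in>schwartz. \<forall>\<psi>\<in>schwartz. u (\<lambda>x. \<phi> x + \<psi> x) = u \<phi> + u \<psi>) \<and>
     (\<forall>c. \<forall>\<phi>\<in>schwartz. u (\<lambda>x. c * \<phi> x) = c * u \<phi>) \<and>
     (\<forall>F \<phi>. (\<forall>i. F i \<in> schwartz) \<and> \<phi> \<in> schwartz \<and> schwartz_tendsto F \<phi>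
        \<longrightarrow> (\<lambda>i. u (F i)) \<longlonglongrightarrow> u \<phi>)"

text \<open>Unconditional convergence of a family of distributions, in the weak sense
  (tested against each Schwartz function).\<close>

definition dist_has_sum ::
    "('i \<Rightarrow> 'a::euclidean_space functional) \<Rightarrow> 'a functional \<Rightarrow> 'i set \<Rightarrow> bool" where
  "dist_has_sum u s I \<longleftrightarrow> (\<forall>\<phi>\<in>schwartz. ((\<lambda>i. u i \<phi>) has_sum s \<phi>) I)"

definition dist_scale :: "complex \<Rightarrow> 'a functional \<Rightarrow> 'a functional" where
  "dist_scale c u = (\<lambda>\<phi>. c * u \<phi>)"

text \<open>\<open>dirac a\<close> is \<open>\<delta>(t - a)\<close>.\<close>

definition dirac :: "'a \<Rightarrow> 'a functional" where
  "dirac a = (\<lambda>\<phi>. \<phi> a)"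

text \<open>\<open>dist_shift a u\<close> is \<open>u(\<cdot> + a)\<close>; substituting \<open>t \<mapsto> t - a\<close> moves the shift,
  with opposite sign, to the test function.\<close>

definition dist_shift :: "'a::euclidean_space \<Rightarrow> 'a functional \<Rightarrow> 'a functional" where
  "dist_shift a u = (\<lambda>\<phi>. u (\<lambda>t. \<phi> (t - a)))"

definition dist_of_fun :: "('a::euclidean_space \<Rightarrow> complex) \<Rightarrow> 'a functional" where
  "dist_of_fun g = (\<lambda>\<phi>. LINT x|lborel. g x * \<phi> x)"

text \<open>For tempered \<open>v\<close> and Schwartz \<open>\<Phi>\<close>, the function \<open>x \<mapsto> v(\<Phi>(x, \<cdot>))\<close> is again
  Schwartz, so \<open>u\<close> is only evaluated at a test function.\<close>

definition dist_tensor ::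
    "'a::euclidean_space functional \<Rightarrow> 'b::euclidean_space functional \<Rightarrow> ('a \<times> 'b) functional" where
  "dist_tensor u v = (\<lambda>\<Phi>. u (\<lambda>x. v (\<lambda>y. \<Phi> (x, y))))"


section \<open>The ZAK representation\<close>

text \<open>In \<open>real \<times> real\<close> the first coordinate is \<open>\<tau>\<close> and the second is \<open>\<nu>\<close>.\<close>

definition zak_term :: "real \<Rightarrow> real functional \<Rightarrow> int \<Rightarrow> (real \<times> real) functional" where
  "zak_term T p n =
     dist_tensor (dist_shift (of_int n * T) p)
       (dist_of_fun (\<lambda>\<nu>. exp (- \<i> * of_real (2 * pi * of_int n * \<nu> * T))))"

definition has_zak :: "real \<Rightarrow> real functional \<Rightarrow> (real \<times> real) functional \<Rightarrow> bool" where
  "has_zak T p Z \<longleftrightarrow>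
     tempered_distribution Z \<and>
     dist_has_sum (\<lambda>n. dist_scale (of_real (sqrt T)) (zak_term T p n)) Z UNIV"

end

theory Submission
  imports Defs "HOL-Probability.Probability"
begin

text \<open>
  Tested against a Schwartz function \<open>\<Phi>\<close>, the \<open>n\<close>-th term of the ZAK series of the impulse train
  is a sum, over the points \<open>x = \<tau>\<^sub>0 + l T\<close>, of Fourier transforms at frequency \<open>n T\<close> of
  \<open>\<Phi> (x, \<cdot>)\<close>. The double sum over \<open>l\<close> and \<open>n\<close> converges absolutely, and summing over \<open>n\<close>
  first turns it into the two-dimensional impulse lattice by the Poisson summation formula.

  For uniqueness, let \<open>u\<close> be the difference of two solutions and test with \<open>\<phi>(\<tau>)\<close> times a Gaussian
  in \<open>\<nu>\<close> of width \<open>s\<close>: then \<open>\<Sum>n. exp (- c (n s)\<^sup>2) u (\<phi> (\<cdot> - n T)) = 0\<close>, and as \<open>s\<close> tends to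
  infinity only the term \<open>n = 0\<close>, which is \<open>u \<phi>\<close>, survives.
\<close>

section \<open>Schwartz functions\<close>

text \<open>The factor \<open>sqrt T\<close> of the signal and the one of the ZAK series multiply to
  the \<open>T\<close> that Poisson summation over a lattice of step \<open>1 / T\<close> requires.
  The shift by \<open>n T\<close> moves impulse \<open>l + n\<close> to \<open>\<tau> + l T\<close>;
  its phase splits into the phase of \<open>l\<close>, which stays as the coefficient of the
  lattice, and the phase of \<open>n\<close>, which is the modulation that offsets the Poisson
  lattice by \<open>\<nu>\<close>. \<open>has_sum\<close> is unconditional, so exchanging the two
  sums requires a bound summable in both indices. Two derivatives in the second variable give a
  factor \<open>1 / (1 + n^2)\<close>, Schwartz decay in the first gives
  \<open>1 / (1 + x^2)\<close>. The Poisson formula is therefore set up for C2 functions with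
  quadratic decay and an explicit constant, which can carry the dependence on \<open>x\<close>. In
  the uniqueness proof only the sum of the ZAK series is known, not its terms, so the terms have to
  be separated by varying the test function. The transform of a Gaussian is a positive Gaussian:
  widening by \<open>s\<close> multiplies the exponent of each weight by \<open>s^2\<close>, so the
  one absolutely convergent series at \<open>s = 1\<close> controls all later tails.\<close>

text \<open>Closure of a whole class under single partial derivatives replaces any formula for
  iterated ones. The uses take for \<open>S\<close> an explicit family: translates, products of two
  factors, polynomials times a Gaussian, integrals against a fixed kernel.\<close>

lemma schwartz_coinduct:
  assumes "f \<in> S"
    and "\<And>f x. f \<in> S \<Longrightarrow> f differentiable at x"
    and "\<And>f k. f \<in> S \<Longrightarrow> \<exists>C. \<forall>x. norm x ^ k * norm (f x) \<le> C"
    and "\<And>f b. f \<in> S \<Longrightarrow> b \<in> Basis \<Longrightarrow> partial_deriv b f \<in> S"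
  shows "f \<in> schwartz"
proof -
  have S: "partial_derivs bs f \<in> S" if "bs \<in> lists Basis" for bs
    using that by (induction bs) (auto intro: assms)
  have "bounded (range (\<lambda>x. norm x ^ k *\<^sub>R partial_derivs bs f x))" if "bs \<in> lists Basis" for k bs
    using assms(3)[OF S[OF that], of k] by (auto simp: bounded_iff)
  with S show ?thesis
    by (auto simp: schwartz_def intro: assms(2))
qed

lemma schwartz_differentiable: "f \<in> schwartz \<Longrightarrow> f differentiable at x"
  unfolding schwartz_def by (auto dest!: bspec[where x="[]"])

lemma schwartz_continuous_on: "f \<in> schwartz \<Longrightarrow> continuous_on A f"
  by (meson continuous_at_imp_continuous_on differentiable_imp_continuous_within schwartz_differentiable)

lemma schwartz_partial_deriv:
  assumes "f \<in> schwartz" "b \<in> Basis"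
  shows "partial_deriv b f \<in> schwartz"
proof -
  have eq: "partial_derivs bs (partial_deriv b f) = partial_derivs (bs @ [b]) f" for bs
    by simp
  show ?thesis
    unfolding schwartz_def mem_Collect_eq eq
  proof (intro conjI ballI allI)
    fix bs :: "'a list" assume "bs \<in> lists Basis"
    then have "bs @ [b] \<in> lists Basis" using assms(2) by simp
    then show "partial_derivs (bs @ [b]) f differentiable at x"
      and "bounded (range (\<lambda>x. norm x ^ k *\<^sub>R partial_derivs (bs @ [b]) f x))" for x k
      using assms(1) unfolding schwartz_def by blast+
  qed
qed

lemma one_plus_power_le:
  fixes r :: real
  assumes "0 \<le> r"
  shows "(1 + r) ^ k \<le> 2 ^ k * (1 + r ^ k)"
proof -
  have "(1 + r) ^ k \<le> (2 * max 1 r) ^ k"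
    using assms by (intro power_mono) auto
  also have "\<dots> = 2 ^ k * max 1 r ^ k"
    by (simp add: power_mult_distrib)
  also have "max 1 r ^ k \<le> 1 + r ^ k"
    using assms by (cases "r \<le> 1") (auto simp: max_def)
  finally show ?thesis by simp
qed

text \<open>The seminorms of orders \<open>0\<close> and \<open>k\<close> together control the
  weight \<open>(1 + norm x) ^ k\<close>. Unlike \<open>norm x ^ k\<close> it never vanishes, so one
  can divide by it, and it is submultiplicative under sums of arguments.\<close>

lemma schwartz_decay:
  assumes "f \<in> schwartz"
  obtains C where "0 < C" "\<And>x. (1 + norm x) ^ k * norm (f x) \<le> C"
proof -
  have "bounded (range (\<lambda>x. norm x ^ j *\<^sub>R partial_derivs [] f x))" for j
    using assms unfolding schwartz_def by blast
  then have "\<exists>B>0. \<forall>x. norm x ^ j * norm (f x) \<le> B" for j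
    by (auto simp: bounded_pos)
  from this[of 0] this[of k] obtain A B where
    AB: "0 < A" "\<And>x. norm (f x) \<le> A" "0 < B" "\<And>x. norm x ^ k * norm (f x) \<le> B"
    by auto
  show ?thesis
  proof
    show "0 < 2 ^ k * (A + B)" using AB by simp
    fix x
    have "(1 + norm x) ^ k * norm (f x) \<le> 2 ^ k * (1 + norm x ^ k) * norm (f x)"
      by (intro mult_right_mono one_plus_power_le) auto
    also have "\<dots> = 2 ^ k * (norm (f x) + norm x ^ k * norm (f x))"
      by (simp add: algebra_simps)
    also have "\<dots> \<le> 2 ^ k * (A + B)"
      using AB(2,4)[of x] by (intro mult_left_mono add_mono) auto
    finally show "(1 + norm x) ^ k * norm (f x) \<le> 2 ^ k * (A + B)" .
  qed
qed

lemma one_plus_square_le_abs: "1 + y\<^sup>2 \<le> (1 + \<bar>y\<bar>)\<^sup>2" for y :: real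
  by (simp add: power2_eq_square algebra_simps flip: abs_mult)

lemma partial_deriv_eq:
  "(f has_derivative f') (at x) \<Longrightarrow> partial_deriv b f x = f' b"
  by (simp add: partial_deriv_def frechet_derivative_at[symmetric])

lemma partial_deriv_eq_vector_derivative:
  "(f has_vector_derivative f') (at x) \<Longrightarrow> partial_deriv 1 f x = f'"
  using partial_deriv_eq[of f "\<lambda>h. h *\<^sub>R f'" x 1] by (simp add: has_vector_derivative_def)

lemma schwartz_has_derivative:
  assumes "f \<in> schwartz"
  shows "(f has_derivative frechet_derivative f (at x)) (at x)"
  using schwartz_differentiable[OF assms] by (simp add: frechet_derivative_works)

lemma schwartz_has_vector_derivative:
  fixes f :: "real \<Rightarrow> complex"
  assumes "f \<in> schwartz"
  shows "(f has_vector_derivative partial_deriv 1 f x) (at x)"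
  using schwartz_differentiable[OF assms, of x]
  by (metis partial_deriv_eq_vector_derivative vector_derivative_works)

lemma schwartz_shift:
  assumes "f \<in> schwartz"
  shows "(\<lambda>x. f (x - a)) \<in> schwartz"
proof (rule schwartz_coinduct[where S="(\<lambda>f x. f (x - a)) ` schwartz"])
  fix g and b :: 'a assume "g \<in> (\<lambda>f x. f (x - a)) ` schwartz"
  then obtain f where f: "f \<in> schwartz" and g: "g = (\<lambda>x. f (x - a))" by blast
  have d: "(g has_derivative frechet_derivative f (at (x - a))) (at x)" for x
    using has_derivative_compose[of "\<lambda>x. x - a" "\<lambda>h. h" x UNIV f, OF _ schwartz_has_derivative[OF f]]
    by (simp add: g has_derivative_diff[OF has_derivative_ident has_derivative_const, of a, simplified])
  show "g differentiable at x" for x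
    using d by (rule differentiableI)
  show "\<exists>C. \<forall>x. norm x ^ k * norm (g x) \<le> C" for k
  proof -
    obtain C where C: "\<And>x. (1 + norm x) ^ k * norm (f x) \<le> C"
      using schwartz_decay[OF f] by metis
    have "norm x ^ k * norm (g x) \<le> (1 + norm a) ^ k * C" for x
    proof -
      have "norm x \<le> norm a + norm (x - a)" by norm
      also have "\<dots> \<le> (1 + norm a) * (1 + norm (x - a))" by (simp add: algebra_simps)
      finally have "norm x ^ k \<le> ((1 + norm a) * (1 + norm (x - a))) ^ k" by (intro power_mono) auto
      then have "norm x ^ k * norm (g x) \<le> ((1 + norm a) * (1 + norm (x - a))) ^ k * norm (g x)"
        by (intro mult_right_mono) auto
      also have "\<dots> = (1 + norm a) ^ k * ((1 + norm (x - a)) ^ k * norm (f (x - a)))"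
        by (simp add: power_mult_distrib g)
      also have "\<dots> \<le> (1 + norm a) ^ k * C"
        by (intro mult_left_mono C) auto
      finally show ?thesis .
    qed
    then show ?thesis by blast
  qed
  assume b: "b \<in> Basis"
  have "partial_deriv b g = (\<lambda>x. partial_deriv b f (x - a))"
    using d by (auto simp: partial_deriv_eq partial_deriv_def[of b f])
  then show "partial_deriv b g \<in> (\<lambda>f x. f (x - a)) ` schwartz"
    using schwartz_partial_deriv[OF f b] by blast
qed (use assms in blast)

text \<open>A derivative in a coordinate direction hits only one factor, so the set of all products
  of two Schwartz functions is closed under \<open>partial_deriv\<close>.\<close>

lemma schwartz_tensor:
  fixes f g :: "real \<Rightarrow> complex"
  assumes "f \<in> schwartz" "g \<in> schwartz"
  shows "(\<lambda>(x, y). f x * g y) \<in> schwartz"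
proof (rule schwartz_coinduct[where S="(\<lambda>(f, g). \<lambda>(x, y). f x * g y) ` (schwartz \<times> schwartz)"])
  fix h :: "real \<times> real \<Rightarrow> complex" and b :: "real \<times> real"
  assume "h \<in> (\<lambda>(f, g). \<lambda>(x, y). f x * g y) ` (schwartz \<times> schwartz)"
  then obtain f g :: "real \<Rightarrow> complex" where f: "f \<in> schwartz" and g: "g \<in> schwartz"
    and h: "h = (\<lambda>z. f (fst z) * g (snd z))" by (auto simp: case_prod_beta')
  have fd: "(f has_derivative (\<lambda>s. s *\<^sub>R partial_deriv 1 f x)) (at x)" for x
    using schwartz_has_vector_derivative[OF f] by (simp add: has_vector_derivative_def)
  have gd: "(g has_derivative (\<lambda>s. s *\<^sub>R partial_deriv 1 g x)) (at x)" for x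
    using schwartz_has_vector_derivative[OF g] by (simp add: has_vector_derivative_def)
  have d: "(h has_derivative (\<lambda>v. f (fst z) * (snd v *\<^sub>R partial_deriv 1 g (snd z))
      + (fst v *\<^sub>R partial_deriv 1 f (fst z)) * g (snd z))) (at z)" for z
    unfolding h
    by (intro has_derivative_mult has_derivative_compose[OF _ fd] has_derivative_compose[OF _ gd]
        has_derivative_fst has_derivative_snd has_derivative_ident)
  show "h differentiable at x" for x
    using d by (rule differentiableI)
  show "\<exists>C. \<forall>z. norm z ^ k * norm (h z) \<le> C" for k
  proof -
    obtain C where C: "0 < C" "\<And>x. (1 + norm x) ^ k * norm (f x) \<le> C"
      using schwartz_decay[OF f] by metis
    obtain D where D: "0 < D" "\<And>x. (1 + norm x) ^ k * norm (g x) \<le> D"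
      using schwartz_decay[OF g] by metis
    have "norm z ^ k * norm (h z) \<le> C * D" for z
    proof -
      have "norm z \<le> norm (fst z) + norm (snd z)"
        by (metis norm_Pair_le prod.collapse)
      also have "\<dots> \<le> (1 + norm (fst z)) * (1 + norm (snd z))" by (simp add: algebra_simps)
      finally have "norm z ^ k \<le> ((1 + norm (fst z)) * (1 + norm (snd z))) ^ k"
        by (intro power_mono) auto
      then have "norm z ^ k * norm (h z) \<le> ((1 + norm (fst z)) * (1 + norm (snd z))) ^ k * norm (h z)"
        by (intro mult_right_mono) auto
      also have "\<dots> = ((1 + norm (fst z)) ^ k * norm (f (fst z))) * ((1 + norm (snd z)) ^ k * norm (g (snd z)))"
        by (simp add: power_mult_distrib h norm_mult)
      also have "\<dots> \<le> C * D"
        using C(1) by (intro mult_mono C D) auto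
      finally show ?thesis .
    qed
    then show ?thesis by blast
  qed
  have d1: "partial_deriv (1, 0) h = (\<lambda>(x, y). partial_deriv 1 f x * g y)"
    and d2: "partial_deriv (0, 1) h = (\<lambda>(x, y). f x * partial_deriv 1 g y)"
    by (auto simp: partial_deriv_eq[OF d] fun_eq_iff)
  assume "b \<in> Basis"
  then consider "b = (1, 0)" | "b = (0, 1)" by (auto simp: Basis_prod_def)
  then show "partial_deriv b h \<in> (\<lambda>(f, g). \<lambda>(x, y). f x * g y) ` (schwartz \<times> schwartz)"
  proof cases
    case 1
    then show ?thesis
      using schwartz_partial_deriv[OF f, of 1] g d1 by (auto intro!: image_eqI[where x="(partial_deriv 1 f, g)"])
  next
    case 2
    then show ?thesis
      using schwartz_partial_deriv[OF g, of 1] f d2 by (auto intro!: image_eqI[where x="(f, partial_deriv 1 g)"])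
  qed
qed (use assms in auto)

section \<open>Gaussians as Schwartz functions\<close>

text \<open>The exponential series of \<open>a * x\<^sup>2\<close> has nonnegative terms, so its
  term of index \<open>k\<close> alone is at most \<open>exp (a * x\<^sup>2)\<close>.\<close>

lemma bounded_power_gauss:
  fixes a :: real
  assumes "0 < a"
  shows "\<exists>C. \<forall>x. \<bar>x\<bar> ^ k * exp (- a * x\<^sup>2) \<le> C"
proof -
  have "\<bar>x\<bar> ^ k * exp (- a * x\<^sup>2) \<le> 1 + fact k / a ^ k" for x
  proof -
    have "(\<Sum>n<Suc k. (a * x\<^sup>2) ^ n / fact n) \<le> exp (a * x\<^sup>2)"
      using sum_le_suminf[OF summable_exp_generic[of "a * x\<^sup>2"], of "{..<Suc k}"] assms
      by (simp add: exp_def divide_inverse mult.commute del: sum.lessThan_Suc)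
    moreover have "(a * x\<^sup>2) ^ k / fact k \<le> (\<Sum>n<Suc k. (a * x\<^sup>2) ^ n / fact n)"
      using assms by (intro member_le_sum) auto
    ultimately have *: "x\<^sup>2 ^ k \<le> fact k / a ^ k * exp (a * x\<^sup>2)"
      using assms by (simp add: power_mult_distrib field_simps)
    \<comment> \<open>The series controls only even powers; the summand 1 covers the region
      \<open>\<bar>x\<bar> \<le> 1\<close>, where passing from exponent \<open>k\<close> to
      \<open>2 * k\<close> would make the power smaller.\<close>
    have "\<bar>x\<bar> ^ k \<le> 1 + (x\<^sup>2) ^ k"
    proof (cases "\<bar>x\<bar> \<le> 1")
      case True
      then have "\<bar>x\<bar> ^ k \<le> 1" by (simp add: power_le_one)
      then show ?thesis by (simp add: add_increasing2)
    next
      case False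
      then have "\<bar>x\<bar> ^ k \<le> \<bar>x\<bar> ^ (2 * k)" by (intro power_increasing) auto
      then show ?thesis by (simp add: power_mult)
    qed
    also have "\<dots> \<le> exp (a * x\<^sup>2) + fact k / a ^ k * exp (a * x\<^sup>2)"
      using * assms by (intro add_mono) auto
    also have "\<dots> = (1 + fact k / a ^ k) * exp (a * x\<^sup>2)"
      by (simp add: algebra_simps)
    finally show ?thesis by (simp add: exp_minus field_simps)
  qed
  then show ?thesis by blast
qed

text \<open>Induction along the coefficients in Horner form. The exponent \<open>k\<close> varies
  because the factor \<open>x\<close> split off by \<open>pCons\<close> raises the weight by
  one.\<close>

lemma bounded_poly_gauss:
  fixes a :: real and q :: "real poly"
  assumes "0 < a"
  shows "\<exists>C. \<forall>x. \<bar>x\<bar> ^ k * \<bar>poly q x * exp (- a * x\<^sup>2)\<bar> \<le> C"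
proof (induction q arbitrary: k)
  case 0
  then show ?case by auto
next
  case (pCons c q)
  obtain C D where C: "\<And>x. \<bar>x\<bar> ^ k * exp (- a * x\<^sup>2) \<le> C"
    and D: "\<And>x. \<bar>x\<bar> ^ Suc k * \<bar>poly q x * exp (- a * x\<^sup>2)\<bar> \<le> D"
    using bounded_power_gauss[OF assms] pCons.IH by meson
  have "\<bar>x\<bar> ^ k * \<bar>poly (pCons c q) x * exp (- a * x\<^sup>2)\<bar> \<le> \<bar>c\<bar> * C + D" for x
  proof -
    have "\<bar>poly (pCons c q) x * exp (- a * x\<^sup>2)\<bar>
        \<le> \<bar>c\<bar> * exp (- a * x\<^sup>2) + \<bar>x\<bar> * \<bar>poly q x * exp (- a * x\<^sup>2)\<bar>"
      using abs_triangle_ineq[of "c * exp (- a * x\<^sup>2)" "x * poly q x * exp (- a * x\<^sup>2)"]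
      by (simp add: algebra_simps abs_mult)
    then have "\<bar>x\<bar> ^ k * \<bar>poly (pCons c q) x * exp (- a * x\<^sup>2)\<bar>
        \<le> \<bar>x\<bar> ^ k * (\<bar>c\<bar> * exp (- a * x\<^sup>2) + \<bar>x\<bar> * \<bar>poly q x * exp (- a * x\<^sup>2)\<bar>)"
      by (intro mult_left_mono) auto
    also have "\<dots> = \<bar>c\<bar> * (\<bar>x\<bar> ^ k * exp (- a * x\<^sup>2)) + \<bar>x\<bar> ^ Suc k * \<bar>poly q x * exp (- a * x\<^sup>2)\<bar>"
      by (simp add: algebra_simps)
    also have "\<dots> \<le> \<bar>c\<bar> * C + D"
      by (intro add_mono mult_left_mono C D) auto
    finally show ?thesis .
  qed
  then show ?case by blast
qed

text \<open>The multiples of a Gaussian by polynomials form a class closed under differentiation: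
  the derivative replaces the polynomial \<open>q\<close> by \<open>q' - 2 a x q\<close>.\<close>

lemma schwartz_gauss:
  fixes a :: real
  assumes "0 < a"
  shows "(\<lambda>x. of_real (c * exp (- a * x\<^sup>2))) \<in> schwartz"
proof -
  define G where "G = (\<lambda>q x. complex_of_real (poly q x * exp (- a * x\<^sup>2)))"
  have d: "(G q has_vector_derivative G (pderiv q - [:0, 2 * a:] * q) x) (at x)" for q x
    unfolding G_def
    by (rule has_vector_derivative_of_real, auto intro!: derivative_eq_intros simp: algebra_simps power2_eq_square)
  have "G [:c:] \<in> schwartz"
  proof (rule schwartz_coinduct[where S="range G"])
    fix f and b :: real assume "f \<in> range G"
    then obtain q where f: "f = G q" by blast
    show "f differentiable at x" for x
      using d unfolding f by (rule differentiableI_vector)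
    show "\<exists>C. \<forall>x. norm x ^ k * norm (f x) \<le> C" for k
      using bounded_poly_gauss[OF assms] by (simp add: f G_def flip: of_real_mult)
    assume "b \<in> Basis"
    then have "partial_deriv b f = G (pderiv q - [:0, 2 * a:] * q)"
      using d by (auto simp: f partial_deriv_eq_vector_derivative)
    then show "partial_deriv b f \<in> range G" by blast
  qed blast
  then show ?thesis by (simp add: G_def)
qed

section \<open>Tempered sums of point masses\<close>

text \<open>Since \<open>u T = (a + u T) - a\<close>, its square is at most twice the sum of the two
  squares. This compares an affine lattice with the integers, and decay in an affine variable with
  decay in the original one.\<close>

lemma one_plus_square_affine_le:
  fixes a T :: real
  assumes "0 < T"
  shows "1 + u\<^sup>2 \<le> (1 + 2 * (1 + a\<^sup>2) / T\<^sup>2) * (1 + (a + u * T)\<^sup>2)"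
proof -
  have "(u * T)\<^sup>2 \<le> 2 * ((a + u * T)\<^sup>2 + a\<^sup>2)"
    using sum_squares_bound[of "- (a + u * T)" a] zero_le_power2[of "a + u * T + a"]
    by (simp add: power2_eq_square algebra_simps)
  also have "\<dots> \<le> 2 * ((1 + a\<^sup>2) * (1 + (a + u * T)\<^sup>2))"
    by (simp add: algebra_simps)
  finally have "u\<^sup>2 * T\<^sup>2 \<le> 2 * (1 + a\<^sup>2) * (1 + (a + u * T)\<^sup>2)"
    unfolding power_mult_distrib mult.assoc .
  then have "u\<^sup>2 \<le> 2 * (1 + a\<^sup>2) * (1 + (a + u * T)\<^sup>2) / T\<^sup>2"
    using assms by (simp add: pos_le_divide_eq)
  then show ?thesis
    by (simp add: distrib_right) (smt (verit) zero_le_power2)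
qed

lemma summable_on_inverse_square_int: "(\<lambda>n::int. 1 / (1 + (of_int n)\<^sup>2) :: real) summable_on UNIV"
proof -
  have "(\<lambda>n::nat. 1 / (1 + (of_nat n)\<^sup>2) :: real) summable_on UNIV"
  proof (rule norm_summable_imp_summable_on, rule summable_comparison_test')
    show "summable (\<lambda>n. 1 / (real n)\<^sup>2)"
      using inverse_power_summable[of 2, where ?'a=real] by (simp add: field_simps)
    show "norm (norm (1 / (1 + (real n)\<^sup>2))) \<le> 1 / (real n)\<^sup>2" if "n \<ge> 1" for n
      using that by (auto intro!: frac_le)
  qed
  then have "(\<lambda>n::int. 1 / (1 + (of_int n)\<^sup>2) :: real) summable_on range int"
    and "(\<lambda>n::int. 1 / (1 + (of_int n)\<^sup>2) :: real) summable_on range (\<lambda>n. - int n)"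
    by (subst summable_on_reindex; auto simp: inj_on_def o_def)+
  then have "(\<lambda>n::int. 1 / (1 + (of_int n)\<^sup>2) :: real) summable_on (range int \<union> range (\<lambda>n. - int n))"
    by (rule summable_on_union)
  also have "range int \<union> range (\<lambda>n. - int n) = UNIV"
    using int_cases2 by (auto simp: set_eq_iff) blast
  finally show ?thesis .
qed

lemma summable_on_inverse_square_affine:
  fixes a T :: real
  assumes "0 < T"
  shows "(\<lambda>n::int. 1 / (1 + (a + of_int n * T)\<^sup>2)) summable_on UNIV"
proof (rule summable_on_comparison_test)
  let ?C = "1 + 2 * (1 + a\<^sup>2) / T\<^sup>2"
  show "(\<lambda>n::int. ?C * (1 / (1 + (of_int n)\<^sup>2))) summable_on UNIV"
    by (intro summable_on_cmult_right summable_on_inverse_square_int)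
  fix n :: int
  have "0 < 1 + (of_int n :: real)\<^sup>2" "0 < 1 + (a + of_int n * T)\<^sup>2"
    by (auto intro: add_pos_nonneg)
  then show "1 / (1 + (a + of_int n * T)\<^sup>2) \<le> ?C * (1 / (1 + (of_int n)\<^sup>2))"
    using one_plus_square_affine_le[OF assms, of "of_int n" a] by (simp add: field_simps)
qed auto

lemma summable_on_product:
  fixes f :: "'a \<Rightarrow> real" and g :: "'b \<Rightarrow> real"
  assumes "f summable_on A" "g summable_on B" "\<And>x. 0 \<le> f x" "\<And>y. 0 \<le> g y"
  shows "(\<lambda>(x, y). f x * g y) summable_on A \<times> B"
  by (rule summable_on_SigmaI[where g="\<lambda>x. f x * infsum g B"])
    (use assms in \<open>auto intro!: has_sum_cmult_right summable_on_cmult_left\<close>)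

text \<open>Everything follows from one estimate: the sum is bounded by \<open>B\<close>, the total
  weight, and the supremum of \<open>(1 + norm x) ^ k * norm (\<phi> x)\<close>. It gives absolute
  convergence, and applied to differences \<open>F i - \<phi>\<close> it gives continuity.\<close>

lemma tempered_point_sum:
  fixes a :: "'i \<Rightarrow> 'a::euclidean_space" and c :: "'i \<Rightarrow> complex"
  assumes w: "(\<lambda>i. 1 / (1 + norm (a i)) ^ k) summable_on UNIV"
    and c: "\<And>i. norm (c i) \<le> B"
  shows "tempered_distribution (\<lambda>\<phi>. \<Sum>\<^sub>\<infinity>i. c i * \<phi> (a i))" (is "tempered_distribution ?u")
    and "dist_has_sum (\<lambda>i. dist_scale (c i) (dirac (a i))) (\<lambda>\<phi>. \<Sum>\<^sub>\<infinity>i. c i * \<phi> (a i)) UNIV"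
proof -
  have B: "0 \<le> B" using c norm_ge_zero order_trans by blast
  have bnd: "norm (c i * \<phi> (a i)) \<le> B * C * (1 / (1 + norm (a i)) ^ k)"
    if "\<And>x. (1 + norm x) ^ k * norm (\<phi> x) \<le> C" for \<phi> :: "'a \<Rightarrow> complex" and C i
  proof -
    have "norm (\<phi> (a i)) \<le> C * (1 / (1 + norm (a i)) ^ k)"
      using that[of "a i"] by (simp add: pos_le_divide_eq mult.commute add_pos_nonneg)
    then have "norm (c i) * norm (\<phi> (a i)) \<le> B * (C * (1 / (1 + norm (a i)) ^ k))"
      using c[of i] B by (intro mult_mono) auto
    then show ?thesis by (simp add: norm_mult)
  qed
  have sums: "(\<lambda>i. c i * \<phi> (a i)) summable_on UNIV"
      "norm (?u \<phi>) \<le> B * C * (\<Sum>\<^sub>\<infinity>i. 1 / (1 + norm (a i)) ^ k)"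
    if "\<And>x. (1 + norm x) ^ k * norm (\<phi> x) \<le> C" for \<phi> :: "'a \<Rightarrow> complex" and C
  proof -
    have s: "(\<lambda>i. B * C * (1 / (1 + norm (a i)) ^ k)) summable_on UNIV"
      by (intro summable_on_cmult_right w)
    have n: "(\<lambda>i. norm (c i * \<phi> (a i))) summable_on UNIV"
      by (rule Infinite_Sum.abs_summable_on_comparison_test'[OF s]) (use bnd[OF that] in simp)
    then show "(\<lambda>i. c i * \<phi> (a i)) summable_on UNIV"
      by (rule abs_summable_summable)
    have "norm (?u \<phi>) \<le> (\<Sum>\<^sub>\<infinity>i. norm (c i * \<phi> (a i)))"
      by (rule norm_infsum_bound[OF n])
    also have "\<dots> \<le> (\<Sum>\<^sub>\<infinity>i. B * C * (1 / (1 + norm (a i)) ^ k))"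
      by (rule infsum_mono[OF n s bnd[OF that]])
    also have "\<dots> = B * C * (\<Sum>\<^sub>\<infinity>i. 1 / (1 + norm (a i)) ^ k)"
      by (rule infsum_cmult_right')
    finally show "norm (?u \<phi>) \<le> B * C * (\<Sum>\<^sub>\<infinity>i. 1 / (1 + norm (a i)) ^ k)" .
  qed
  have schw: "(\<lambda>i. c i * \<phi> (a i)) summable_on UNIV" if "\<phi> \<in> schwartz" for \<phi>
    using schwartz_decay[OF that] sums(1) by metis
  then show "dist_has_sum (\<lambda>i. dist_scale (c i) (dirac (a i))) ?u UNIV"
    by (auto simp: dist_has_sum_def dist_scale_def dirac_def)
  show "tempered_distribution ?u"
    unfolding tempered_distribution_def
  proof (intro conjI ballI allI impI)
    fix \<phi> \<psi> :: "'a \<Rightarrow> complex" assume "\<phi> \<in> schwartz" "\<psi> \<in> schwartz"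
    then show "?u (\<lambda>x. \<phi> x + \<psi> x) = ?u \<phi> + ?u \<psi>"
      by (simp add: distrib_left infsum_add schw)
  next
    fix d and \<phi> :: "'a \<Rightarrow> complex"
    show "?u (\<lambda>x. d * \<phi> x) = d * ?u \<phi>"
      by (subst infsum_cmult_right'[symmetric]) (simp add: mult.left_commute)
  next
    fix F :: "nat \<Rightarrow> 'a \<Rightarrow> complex" and \<phi>
    assume "(\<forall>i. F i \<in> schwartz) \<and> \<phi> \<in> schwartz \<and> schwartz_tendsto F \<phi>"
    then have F: "\<And>i. F i \<in> schwartz" and \<phi>: "\<phi> \<in> schwartz" and
      lim: "\<And>j. uniform_limit UNIV (\<lambda>i x. norm x ^ j *\<^sub>R partial_derivs [] (F i) x)
          (\<lambda>x. norm x ^ j *\<^sub>R partial_derivs [] \<phi> x) sequentially"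
      unfolding schwartz_tendsto_def by (blast intro: lists.Nil)+
    define W where "W = (\<Sum>\<^sub>\<infinity>i. 1 / (1 + norm (a i)) ^ k)"
    have W: "0 \<le> W" unfolding W_def by (intro infsum_nonneg) auto
    show "(\<lambda>i. ?u (F i)) \<longlonglongrightarrow> ?u \<phi>"
    proof (rule tendstoI)
      fix e :: real assume "0 < e"
      \<comment> \<open>If the seminorms of orders \<open>0\<close> and \<open>k\<close> of the
        difference are below \<open>d\<close>, then \<open>one_plus_power_le\<close> turns them into
        the weighted bound \<open>2 ^ k * (d + d)\<close>, and the functional changes by at most
        \<open>D * d\<close>. The \<open>+ 1\<close> in the next line covers
        \<open>D = 0\<close>.\<close>
      define D where "D = B * 2 ^ k * 2 * W"
      define d where "d = e / (D + 1)"
      have D: "0 \<le> D" using W B by (auto simp: D_def)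
      with \<open>0 < e\<close> have d: "0 < d" "D * d < e"
        by (auto simp: d_def field_simps add_nonneg_pos)
      from d(2) have d2: "B * (2 ^ k * (d + d)) * W < e"
        by (simp add: D_def algebra_simps)
      have "\<forall>\<^sub>F i in sequentially. \<forall>x. norm (norm x ^ j *\<^sub>R F i x - norm x ^ j *\<^sub>R \<phi> x) < d" for j
        using uniform_limitD[OF lim[of j] d(1)] by (simp add: dist_norm)
      from eventually_conj[OF this[of 0] this[of k]]
      show "\<forall>\<^sub>F i in sequentially. dist (?u (F i)) (?u \<phi>) < e"
      proof eventually_elim
        case (elim i)
        have "(1 + norm x) ^ k * norm (F i x - \<phi> x) \<le> 2 ^ k * (d + d)" for x
        proof -
          have 1: "norm (F i x - \<phi> x) \<le> d" "norm x ^ k * norm (F i x - \<phi> x) \<le> d"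
            using elim[THEN conjunct1, THEN spec, of x] elim[THEN conjunct2, THEN spec, of x]
            by (auto simp: scaleR_diff_right[symmetric] simp del: scaleR_conv_of_real)
          have "(1 + norm x) ^ k * norm (F i x - \<phi> x) \<le> 2 ^ k * (1 + norm x ^ k) * norm (F i x - \<phi> x)"
            by (intro mult_right_mono one_plus_power_le) auto
          also have "\<dots> = 2 ^ k * (norm (F i x - \<phi> x) + norm x ^ k * norm (F i x - \<phi> x))"
            by (simp add: algebra_simps)
          also have "\<dots> \<le> 2 ^ k * (d + d)"
            by (intro mult_left_mono add_mono 1) auto
          finally show ?thesis .
        qed
        from sums(2)[OF this] have "norm (?u (\<lambda>x. F i x - \<phi> x)) < e"
          using d2 unfolding W_def by linarith
        moreover have "?u (\<lambda>x. F i x - \<phi> x) = ?u (F i) - ?u \<phi>"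
          using infsum_add[OF schw[OF F[of i]] summable_on_uminus[THEN iffD2, OF schw[OF \<phi>]]]
          by (simp add: right_diff_distrib infsum_uminus)
        ultimately show ?case by (simp add: dist_norm)
      qed
    qed
  qed
qed

section \<open>Partial integrals of Schwartz functions\<close>

lemma integrable_inverse_square: "integrable lborel (\<lambda>x::real. 1 / (1 + x\<^sup>2))"
  using integrable_inverse_1_plus_square by (simp add: set_integrable_def inverse_eq_divide)

lemma integrable_decay:
  fixes f :: "real \<Rightarrow> complex"
  assumes [measurable]: "f \<in> borel_measurable borel" and "\<And>x. (1 + x\<^sup>2) * norm (f x) \<le> B"
  shows "integrable lborel f" and "norm (LINT x|lborel. f x) \<le> B * (LINT x|lborel. 1 / (1 + x\<^sup>2 :: real))"
proof -
  have b: "norm (f x) \<le> B * (1 / (1 + x\<^sup>2))" for x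
    using assms(2)[of x] by (simp add: pos_le_divide_eq mult.commute add_pos_nonneg)
  have i: "integrable lborel (\<lambda>x::real. B * (1 / (1 + x\<^sup>2)))"
    by (intro integrable_mult_right integrable_inverse_square)
  show 1: "integrable lborel f"
  proof (rule Bochner_Integration.integrable_bound[OF i], measurable, rule AE_I2)
    show "norm (f x) \<le> norm (B * (1 / (1 + x\<^sup>2)))" for x
      using b[of x] unfolding real_norm_def by (rule order_trans[OF _ abs_ge_self])
  qed
  have "norm (LINT x|lborel. f x) \<le> (LINT x|lborel. norm (f x))"
    by (rule integral_norm_bound)
  also have "\<dots> \<le> (LINT x|lborel. B * (1 / (1 + x\<^sup>2)))"
    by (intro integral_mono integrable_norm 1 i b)
  finally show "norm (LINT x|lborel. f x) \<le> B * (LINT x|lborel. 1 / (1 + x\<^sup>2 :: real))"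
    by (simp only: integral_mult_right_zero)
qed

text \<open>A first-order remainder bounded by a multiple of the squared increment survives
  integration over a parameter. Together with the next lemma this justifies differentiating under
  the integral sign.\<close>

lemma has_vector_derivative_quadratic:
  fixes f :: "real \<Rightarrow> 'a::real_normed_vector"
  assumes "\<And>y. norm (f y - f x - (y - x) *\<^sub>R d) \<le> K * (y - x)\<^sup>2"
  shows "(f has_vector_derivative d) (at x)"
  unfolding has_vector_derivative_def has_derivative_at_within
proof (intro conjI bounded_linear_scaleR_left)
  have "((\<lambda>y. K * \<bar>y - x\<bar>) \<longlongrightarrow> K * \<bar>x - x\<bar>) (at x)"
    by (intro tendsto_intros)
  then have lim: "((\<lambda>y. K * \<bar>y - x\<bar>) \<longlongrightarrow> 0) (at x)" by simp
  show "((\<lambda>y. (f y - f x - (y - x) *\<^sub>R d) /\<^sub>R norm (y - x)) \<longlongrightarrow> 0) (at x)"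
  proof (rule Lim_null_comparison[OF _ lim], rule eventually_at_filter[THEN iffD2], intro always_eventually allI impI)
    fix y assume "y \<noteq> x"
    then show "norm ((f y - f x - (y - x) *\<^sub>R d) /\<^sub>R norm (y - x)) \<le> K * \<bar>y - x\<bar>"
      using assms[of y]
      by (simp add: pos_divide_le_eq inverse_eq_divide mult.assoc power2_eq_square
          flip: abs_mult)
  qed
qed

text \<open>The mean value inequality is applied twice: to \<open>f'\<close>, whose variation is at
  most \<open>M * \<bar>y - x\<bar>\<close>, and then to the linearization error of
  \<open>f\<close>. The constant is twice that of Taylor's formula, which is harmless here.\<close>

lemma quadratic_remainder_bound:
  fixes f :: "real \<Rightarrow> complex"
  assumes "\<And>x. (f has_vector_derivative f' x) (at x)"
    and "\<And>x. (f' has_vector_derivative f'' x) (at x)"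
    and "\<And>x. norm (f'' x) \<le> M"
  shows "norm (f y - f x - (y - x) *\<^sub>R f' x) \<le> M * (y - x)\<^sup>2"
proof -
  have "norm (f' z - f' x) \<le> M * \<bar>y - x\<bar>" if "z \<in> closed_segment x y" for z
  proof -
    have "norm (f' z - f' x) \<le> M * norm (z - x)"
    proof (rule differentiable_bound[where f'="\<lambda>x h. h *\<^sub>R f'' x" and S=UNIV])
      show "(f' has_derivative (\<lambda>h. h *\<^sub>R f'' x)) (at x)" for x
        using assms(2) by (simp add: has_vector_derivative_def)
      show "onorm (\<lambda>h. h *\<^sub>R f'' x) \<le> M" for x
        using assms(3)[of x] by (intro onorm_le) (simp add: mult.commute[of M] mult_left_mono)
    qed auto
    moreover have "0 \<le> M" using assms(3) norm_ge_zero order_trans by blast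
    moreover have "norm (z - x) \<le> \<bar>y - x\<bar>"
      using segment_bound1[OF that] by simp
    ultimately show ?thesis by (meson mult_left_mono order_trans)
  qed
  then have "norm (f y - f x - (y - x) *\<^sub>R f' x) \<le> norm (y - x) * (M * \<bar>y - x\<bar>)"
    by (intro vector_differentiable_bound_linearization[where S="closed_segment x y"])
      (auto intro: has_vector_derivative_at_within assms(1))
  then show ?thesis by (simp add: power2_eq_square mult.left_commute flip: abs_mult)
qed

text \<open>Of the \<open>k + 2\<close> powers of \<open>1 + norm (x, y)\<close>, two are spent on
  the second coordinate, to make it integrable, and \<open>k\<close> on the first.\<close>

lemma schwartz_prod_decay:
  fixes \<Phi> :: "real \<times> real \<Rightarrow> complex"
  assumes "\<Phi> \<in> schwartz"
  obtains C where "0 < C" "\<And>x y. (1 + \<bar>x\<bar>) ^ k * ((1 + y\<^sup>2) * norm (\<Phi> (x, y))) \<le> C"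
proof -
  obtain C where C: "0 < C" "\<And>z. (1 + norm z) ^ (k + 2) * norm (\<Phi> z) \<le> C"
    using schwartz_decay[OF assms] by metis
  have "(1 + \<bar>x\<bar>) ^ k * ((1 + y\<^sup>2) * norm (\<Phi> (x, y))) \<le> C" for x y
  proof -
    have xy: "\<bar>x\<bar> \<le> norm (x, y)" "\<bar>y\<bar> \<le> norm (x, y)"
      by (auto simp: norm_prod_def intro: real_le_rsqrt)
    have "1 + y\<^sup>2 \<le> (1 + \<bar>y\<bar>)\<^sup>2"
      by (rule one_plus_square_le_abs)
    also have "\<dots> \<le> (1 + norm (x, y))\<^sup>2"
      using xy by (intro power_mono) auto
    finally have "(1 + \<bar>x\<bar>) ^ k * (1 + y\<^sup>2) \<le> (1 + norm (x, y)) ^ k * (1 + norm (x, y))\<^sup>2"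
      using xy by (intro mult_mono power_mono) auto
    then have "(1 + \<bar>x\<bar>) ^ k * (1 + y\<^sup>2) * norm (\<Phi> (x, y)) \<le> (1 + norm (x, y)) ^ (k + 2) * norm (\<Phi> (x, y))"
      by (intro mult_right_mono) (auto simp: power_add power2_eq_square mult_ac)
    also have "\<dots> \<le> C" by (rule C)
    finally show ?thesis by (simp add: mult.assoc)
  qed
  with C(1) show ?thesis by (rule that)
qed

lemma schwartz_fst_vector_derivative:
  fixes \<Phi> :: "real \<times> real \<Rightarrow> complex"
  assumes "\<Phi> \<in> schwartz"
  shows "((\<lambda>x. \<Phi> (x, y)) has_vector_derivative partial_deriv (1, 0) \<Phi> (x, y)) (at x)"
  unfolding has_vector_derivative_def
proof (rule has_derivative_eq_rhs)
  show "((\<lambda>x. \<Phi> (x, y)) has_derivative (\<lambda>h. frechet_derivative \<Phi> (at (x, y)) (h, 0))) (at x)"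
    by (rule has_derivative_compose[OF has_derivative_Pair[OF has_derivative_ident has_derivative_const]
          schwartz_has_derivative[OF assms]])
  have scale: "frechet_derivative \<Phi> (at (x, y)) (h *\<^sub>R (1, 0)) = h *\<^sub>R frechet_derivative \<Phi> (at (x, y)) (1, 0)" for h
    by (rule linear_scale[OF has_derivative_linear[OF schwartz_has_derivative[OF assms]]])
  show "(\<lambda>h. frechet_derivative \<Phi> (at (x, y)) (h, 0)) = (\<lambda>h. h *\<^sub>R partial_deriv (1, 0) \<Phi> (x, y))"
    by (rule ext) (simp add: partial_deriv_def flip: scale)
qed

lemma schwartz_snd_vector_derivative:
  fixes \<Phi> :: "real \<times> real \<Rightarrow> complex"
  assumes "\<Phi> \<in> schwartz"
  shows "((\<lambda>y. \<Phi> (x, y)) has_vector_derivative partial_deriv (0, 1) \<Phi> (x, y)) (at y)"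
  unfolding has_vector_derivative_def
proof (rule has_derivative_eq_rhs)
  show "((\<lambda>y. \<Phi> (x, y)) has_derivative (\<lambda>h. frechet_derivative \<Phi> (at (x, y)) (0, h))) (at y)"
    by (rule has_derivative_compose[OF has_derivative_Pair[OF has_derivative_const has_derivative_ident]
          schwartz_has_derivative[OF assms]])
  have scale: "frechet_derivative \<Phi> (at (x, y)) (h *\<^sub>R (0, 1)) = h *\<^sub>R frechet_derivative \<Phi> (at (x, y)) (0, 1)" for h
    by (rule linear_scale[OF has_derivative_linear[OF schwartz_has_derivative[OF assms]]])
  show "(\<lambda>h. frechet_derivative \<Phi> (at (x, y)) (0, h)) = (\<lambda>h. h *\<^sub>R partial_deriv (0, 1) \<Phi> (x, y))"
    by (rule ext) (simp add: partial_deriv_def flip: scale)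
qed

lemma schwartz_snd_measurable [measurable (raw)]:
  fixes \<Phi> :: "real \<times> real \<Rightarrow> complex"
  assumes "\<Phi> \<in> schwartz"
  shows "(\<lambda>y. \<Phi> (x, y)) \<in> borel_measurable borel"
proof (rule borel_measurable_continuous_onI, rule continuous_on_compose2[OF schwartz_continuous_on[OF assms, of UNIV]])
  show "continuous_on UNIV (Pair x)" by (intro continuous_intros)
qed auto

text \<open>The derivative of such an integral is the integral with
  \<open>partial_deriv (1, 0) \<Phi>\<close> in place of \<open>\<Phi>\<close>, so the image of
  \<open>schwartz\<close> is the invariant class. All regularity comes from \<open>\<Phi>\<close>;
  the kernel \<open>g\<close> is merely bounded and measurable.\<close>

lemma schwartz_partial_integral:
  fixes \<Phi> :: "real \<times> real \<Rightarrow> complex" and g :: "real \<Rightarrow> complex"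
  assumes \<Phi>: "\<Phi> \<in> schwartz"
    and g [measurable]: "g \<in> borel_measurable borel" and g1: "\<And>y. norm (g y) \<le> 1"
  shows "(\<lambda>x. LINT y|lborel. g y * \<Phi> (x, y)) \<in> schwartz"
proof (rule schwartz_coinduct[where S="(\<lambda>\<Phi> x. LINT y|lborel. g y * \<Phi> (x, y)) ` schwartz"])
  fix f :: "real \<Rightarrow> complex" and b :: real
  assume "f \<in> (\<lambda>\<Phi> x. LINT y|lborel. g y * \<Phi> (x, y)) ` schwartz"
  then obtain \<Phi> where \<Phi>: "\<Phi> \<in> schwartz" and f: "f = (\<lambda>x. LINT y|lborel. g y * \<Phi> (x, y))"
    by blast
  define W where "W = (LINT x|lborel. 1 / (1 + x\<^sup>2 :: real))"
  define \<Phi>1 where "\<Phi>1 = partial_deriv (1, 0) \<Phi>"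
  have b: "(1 :: real, 0 :: real) \<in> Basis" by (simp add: Basis_prod_def)
  have \<Phi>1: "\<Phi>1 \<in> schwartz" unfolding \<Phi>1_def by (rule schwartz_partial_deriv[OF \<Phi> b])
  note [measurable] = schwartz_snd_measurable[OF \<Phi>] schwartz_snd_measurable[OF \<Phi>1]
  have g2: "norm (g y * z) \<le> norm z" for y z
    using mult_right_mono[OF g1[of y], of "norm z"] by (simp add: norm_mult)
  have bound: "norm (LINT y|lborel. g y * h y) \<le> B * W"
    if [measurable]: "h \<in> borel_measurable borel" and "\<And>y. (1 + y\<^sup>2) * norm (h y) \<le> B" for h B
    unfolding W_def
    by (rule integrable_decay, measurable, rule order_trans[OF mult_left_mono[OF g2] that(2)]) simp
  have int: "integrable lborel (\<lambda>y. g y * h y)"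
    if [measurable]: "h \<in> borel_measurable borel" and "\<And>y. (1 + y\<^sup>2) * norm (h y) \<le> B" for h B
    by (rule integrable_decay, measurable, rule order_trans[OF mult_left_mono[OF g2] that(2)]) simp
  have int\<Phi>: "integrable lborel (\<lambda>y. g y * \<Phi> (x, y))" if \<Phi>: "\<Phi> \<in> schwartz" for \<Phi> :: "real \<times> real \<Rightarrow> complex" and x
  proof -
    obtain C where "\<And>x y. (1 + \<bar>x\<bar>) ^ 0 * ((1 + y\<^sup>2) * norm (\<Phi> (x, y))) \<le> C"
      using schwartz_prod_decay[OF \<Phi>] by blast
    then show ?thesis
      by (intro int[where B=C] schwartz_snd_measurable[OF \<Phi>]) simp
  qed
  have d: "(f has_vector_derivative (LINT y|lborel. g y * \<Phi>1 (x, y))) (at x)" for x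
  proof -
    obtain C where "\<And>x y. (1 + \<bar>x\<bar>) ^ 0 * ((1 + y\<^sup>2) * norm (partial_deriv (1, 0) \<Phi>1 (x, y))) \<le> C"
      using schwartz_prod_decay[OF schwartz_partial_deriv[OF \<Phi>1 b]] by blast
    then have C: "\<And>x y. (1 + y\<^sup>2) * norm (partial_deriv (1, 0) \<Phi>1 (x, y)) \<le> C"
      by simp
    have "norm (f z - f x - (z - x) *\<^sub>R (LINT y|lborel. g y * \<Phi>1 (x, y))) \<le> (C * W) * (z - x)\<^sup>2" for z
    proof -
      have "f z - f x - (z - x) *\<^sub>R (LINT y|lborel. g y * \<Phi>1 (x, y)) =
          (LINT y|lborel. g y * \<Phi> (z, y) - g y * \<Phi> (x, y) - (z - x) *\<^sub>R (g y * \<Phi>1 (x, y)))"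
        unfolding f by (simp add: int\<Phi> \<Phi> \<Phi>1 del: scaleR_conv_of_real)
      also have "\<dots> = (LINT y|lborel. g y * (\<Phi> (z, y) - \<Phi> (x, y) - (z - x) *\<^sub>R \<Phi>1 (x, y)))"
        by (simp add: algebra_simps)
      also have "norm \<dots> \<le> (C * (z - x)\<^sup>2) * W"
      proof (rule bound)
        fix y :: real
        have p: "0 < 1 + y\<^sup>2" by (simp add: add_pos_nonneg)
        \<comment> \<open>For fixed \<open>y\<close> the second derivative in the first variable is
          bounded by \<open>C / (1 + y\<^sup>2)\<close>; this makes the remainder integrable in
          \<open>y\<close> while it stays quadratic in \<open>z - x\<close>.\<close>
        have "norm (\<Phi> (z, y) - \<Phi> (x, y) - (z - x) *\<^sub>R \<Phi>1 (x, y)) \<le> C / (1 + y\<^sup>2) * (z - x)\<^sup>2"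
        proof (rule quadratic_remainder_bound)
          show "((\<lambda>x. \<Phi> (x, y)) has_vector_derivative \<Phi>1 (x, y)) (at x)" for x
            unfolding \<Phi>1_def by (rule schwartz_fst_vector_derivative[OF \<Phi>])
          show "((\<lambda>x. \<Phi>1 (x, y)) has_vector_derivative partial_deriv (1, 0) \<Phi>1 (x, y)) (at x)" for x
            by (rule schwartz_fst_vector_derivative[OF \<Phi>1])
          show "norm (partial_deriv (1, 0) \<Phi>1 (x, y)) \<le> C / (1 + y\<^sup>2)" for x
            using C[of y x] p by (simp add: pos_le_divide_eq mult.commute)
        qed
        then show "(1 + y\<^sup>2) * norm (\<Phi> (z, y) - \<Phi> (x, y) - (z - x) *\<^sub>R \<Phi>1 (x, y)) \<le> C * (z - x)\<^sup>2"
          using p by (simp add: pos_le_divide_eq mult.commute)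
      qed measurable
      finally show ?thesis by (simp add: mult_ac)
    qed
    then show ?thesis by (rule has_vector_derivative_quadratic)
  qed
  show "f differentiable at x" for x
    using d by (rule differentiableI_vector)
  show "\<exists>C. \<forall>x. norm x ^ k * norm (f x) \<le> C" for k
  proof -
    obtain C where C: "0 < C" "\<And>x y. (1 + \<bar>x\<bar>) ^ k * ((1 + y\<^sup>2) * norm (\<Phi> (x, y))) \<le> C"
      using schwartz_prod_decay[OF \<Phi>] by blast
    have "norm x ^ k * norm (f x) \<le> C * W" for x
    proof -
      \<comment> \<open>For fixed \<open>x\<close> the constant in the \<open>y\<close>-decay may
        itself depend on \<open>x\<close>, and so hands the decay in \<open>x\<close> on to the
        integral.\<close>
      have "norm (f x) \<le> (C / (1 + \<bar>x\<bar>) ^ k) * W"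
        unfolding f using C(2)[of x]
        by (intro bound) (auto simp: pos_le_divide_eq mult.commute add_pos_nonneg)
      then have "(1 + \<bar>x\<bar>) ^ k * norm (f x) \<le> C * W"
        by (simp add: pos_le_divide_eq mult.commute add_pos_nonneg)
      moreover have "norm x ^ k * norm (f x) \<le> (1 + \<bar>x\<bar>) ^ k * norm (f x)"
        by (intro mult_right_mono power_mono) auto
      ultimately show ?thesis by linarith
    qed
    then show ?thesis by blast
  qed
  assume "b \<in> Basis"
  then have "partial_deriv b f = (\<lambda>x. LINT y|lborel. g y * \<Phi>1 (x, y))"
    using partial_deriv_eq_vector_derivative[OF d] by auto
  then show "partial_deriv b f \<in> (\<lambda>\<Phi> x. LINT y|lborel. g y * \<Phi> (x, y)) ` schwartz"
    using \<Phi>1 by blast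
qed (rule image_eqI[OF refl assms(1)])

section \<open>Poisson summation\<close>

definition fchar :: "int \<Rightarrow> real \<Rightarrow> complex" where
  "fchar n x = cis (- (2 * pi * of_int n * x))"

lemma norm_fchar [simp]: "norm (fchar n x) = 1"
  by (simp add: fchar_def)

lemma fchar_0 [simp]: "fchar 0 x = 1" "fchar n 0 = 1"
  by (simp_all add: fchar_def)

lemma fchar_of_int [simp]: "fchar n (of_int m) = 1"
proof -
  have "fchar n (of_int m) = cis (2 * pi * of_int (- (n * m)))"
    by (simp add: fchar_def algebra_simps)
  then show ?thesis by (simp only: cis_multiple_2pi Ints_of_int)
qed

lemma fchar_add: "fchar n (x + y) = fchar n x * fchar n y"
  by (simp add: fchar_def cis_mult algebra_simps)

lemma fchar_Suc: "fchar (n + 1) x = fchar n x * fchar 1 x"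
  by (simp add: fchar_def cis_mult algebra_simps)

lemma fchar_has_vector_derivative:
  "(fchar n has_vector_derivative (- (2 * pi * of_int n * \<i>)) * fchar n x) (at x within A)"
proof -
  have "((\<lambda>x. cis (- (2 * pi * of_int n * x))) has_derivative
      (\<lambda>h. (- (2 * pi * of_int n * h)) *\<^sub>R (\<i> * cis (- (2 * pi * of_int n * x))))) (at x within A)"
    by (auto intro!: derivative_eq_intros simp: algebra_simps)
  then show ?thesis
    unfolding fchar_def[abs_def] has_vector_derivative_def
    by (rule has_derivative_eq_rhs) (auto simp: scaleR_conv_of_real)
qed

lemma continuous_on_fchar [continuous_intros]: "continuous_on A (fchar n)"
  unfolding continuous_on_eq_continuous_within
  using fchar_has_vector_derivative has_vector_derivative_continuous by blast

lemma fchar_measurable [measurable]: "fchar n \<in> borel_measurable borel"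
  by (intro borel_measurable_continuous_onI continuous_on_fchar)

text \<open>The fundamental theorem of calculus on the whole line; quadratic decay makes both
  boundary values zero.\<close>

lemma integral_vector_derivative_decay_eq_0:
  fixes F F' :: "real \<Rightarrow> complex"
  assumes F: "\<And>x. (F has_vector_derivative F' x) (at x)"
    and F': "continuous_on UNIV F'"
    and bF: "\<And>x. (1 + x\<^sup>2) * norm (F x) \<le> B" and bF': "\<And>x. (1 + x\<^sup>2) * norm (F' x) \<le> B'"
  shows "(LINT x|lborel. F' x) = 0"
proof -
  have b: "norm (F x) \<le> B * inverse (1 + x\<^sup>2)" for x
    using bF[of x] by (simp add: pos_le_divide_eq mult.commute add_pos_nonneg flip: divide_inverse)
  have lim: "(F \<longlongrightarrow> 0) at_top" "(F \<longlongrightarrow> 0) at_bot"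
  proof -
    have "((\<lambda>x. B * inverse (1 + x\<^sup>2)) \<longlongrightarrow> B * 0) at_top" "((\<lambda>x. B * inverse (1 + x\<^sup>2)) \<longlongrightarrow> B * 0) at_bot"
      by (intro tendsto_intros tendsto_inverse_0_at_top filterlim_tendsto_add_at_top[OF tendsto_const]
          filterlim_pow_at_top filterlim_pow_at_bot_even filterlim_ident; simp)+
    then show "(F \<longlongrightarrow> 0) at_top" "(F \<longlongrightarrow> 0) at_bot"
      by (auto intro: Lim_null_comparison[OF always_eventually[OF allI[OF b]]])
  qed
  have "(LBINT x=-\<infinity>..\<infinity>. F' x) = 0 - 0"
  proof (rule interval_integral_FTC_integrable[where F=F])
    show "set_integrable lborel (einterval (-\<infinity>) \<infinity>) F'"
      using integrable_decay(1)[OF borel_measurable_continuous_onI[OF F'] bF']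
      by (simp add: set_integrable_def)
    show "isCont F' x" for x
      using F' by (simp add: continuous_on_eq_continuous_at)
  qed (auto simp: F lim ereal_tendsto_simps)
  then show ?thesis
    by (simp add: interval_lebesgue_integral_def set_lebesgue_integral_def)
qed

text \<open>Integration by parts: the derivative of \<open>fchar n x * f x\<close> integrates to
  zero.\<close>

lemma fourier_coefficient_derivative:
  fixes f f' :: "real \<Rightarrow> complex"
  assumes f: "\<And>x. (f has_vector_derivative f' x) (at x)" and f': "continuous_on UNIV f'"
    and b: "\<And>x. (1 + x\<^sup>2) * norm (f x) \<le> B" and b': "\<And>x. (1 + x\<^sup>2) * norm (f' x) \<le> B"
  shows "(LINT x|lborel. fchar n x * f' x) = (2 * pi * of_int n * \<i>) * (LINT x|lborel. fchar n x * f x)"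
proof -
  have cf: "continuous_on UNIV f"
    using f has_vector_derivative_continuous by (metis continuous_at_imp_continuous_on)
  have [measurable]: "f \<in> borel_measurable borel" "f' \<in> borel_measurable borel"
    by (intro borel_measurable_continuous_onI f' cf)+
  have int: "integrable lborel (\<lambda>x. fchar n x * f x)" "integrable lborel (\<lambda>x. fchar n x * f' x)"
    by (rule integrable_decay(1)[where B=B]; simp add: norm_mult b b')+
  have "(LINT x|lborel. fchar n x * f' x + (- (2 * pi * of_int n * \<i>)) * (fchar n x * f x)) = 0"
  proof (rule integral_vector_derivative_decay_eq_0[where F="\<lambda>x. fchar n x * f x"])
    show "((\<lambda>x. fchar n x * f x) has_vector_derivative
        fchar n x * f' x + (- (2 * pi * of_int n * \<i>)) * (fchar n x * f x)) (at x)" for x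
      using has_vector_derivative_mult[OF fchar_has_vector_derivative f] by (simp add: mult.assoc)
    show "continuous_on UNIV (\<lambda>x. fchar n x * f' x + (- (2 * pi * of_int n * \<i>)) * (fchar n x * f x))"
      by (intro continuous_intros f' cf)
    show "(1 + x\<^sup>2) * norm (fchar n x * f x) \<le> B" for x
      using b by (simp add: norm_mult)
    show "(1 + x\<^sup>2) * norm (fchar n x * f' x + (- (2 * pi * of_int n * \<i>)) * (fchar n x * f x))
        \<le> B + norm (2 * pi * of_int n * \<i>) * B" for x
    proof -
      have "norm (fchar n x * f' x + (- (2 * pi * of_int n * \<i>)) * (fchar n x * f x))
        \<le> norm (f' x) + norm (2 * pi * of_int n * \<i>) * norm (f x)"
        using norm_triangle_ineq[of "fchar n x * f' x" "(- (2 * pi * of_int n * \<i>)) * (fchar n x * f x)"]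
        by (simp add: norm_mult)
      then have "(1 + x\<^sup>2) * norm (fchar n x * f' x + (- (2 * pi * of_int n * \<i>)) * (fchar n x * f x))
        \<le> (1 + x\<^sup>2) * (norm (f' x) + norm (2 * pi * of_int n * \<i>) * norm (f x))"
        by (rule mult_left_mono) simp
      also have "\<dots> = (1 + x\<^sup>2) * norm (f' x) + norm (2 * pi * of_int n * \<i>) * ((1 + x\<^sup>2) * norm (f x))"
        by (simp only: distrib_left mult.left_commute)
      also have "\<dots> \<le> B + norm (2 * pi * of_int n * \<i>) * B"
        by (intro add_mono b' mult_left_mono b) auto
      finally show ?thesis .
    qed
  qed
  moreover have "(LINT x|lborel. fchar n x * f' x + a * (fchar n x * f x)) =
      (LINT x|lborel. fchar n x * f' x) + a * (LINT x|lborel. fchar n x * f x)" for a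
    by (simp add: int)
  ultimately have "(LINT x|lborel. fchar n x * f' x)
      + (- (2 * pi * of_int n * \<i>)) * (LINT x|lborel. fchar n x * f x) = 0"
    by metis
  then show ?thesis by simp
qed

text \<open>Two integrations by parts bound \<open>(2 * pi * n)\<^sup>2\<close> times the
  coefficient by the integral of \<open>f''\<close>. The direct bound on the integral of
  \<open>f\<close> supplies the summand 1 of the weight and covers \<open>n = 0\<close>; adding the
  two gives the factor 2.\<close>

lemma fourier_coefficient_decay:
  fixes f f' f'' :: "real \<Rightarrow> complex"
  assumes "\<And>x. (f has_vector_derivative f' x) (at x)" "\<And>x. (f' has_vector_derivative f'' x) (at x)"
    and c: "continuous_on UNIV f''"
    and b: "\<And>x. (1 + x\<^sup>2) * norm (f x) \<le> B" "\<And>x. (1 + x\<^sup>2) * norm (f' x) \<le> B"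
      "\<And>x. (1 + x\<^sup>2) * norm (f'' x) \<le> B"
  shows "(1 + (of_int n)\<^sup>2) * norm (LINT x|lborel. fchar n x * f x) \<le> 2 * B * (LINT x|lborel. 1 / (1 + x\<^sup>2 :: real))"
proof -
  define W where "W = (LINT x|lborel. 1 / (1 + x\<^sup>2 :: real))"
  define c where "c = (LINT x|lborel. fchar n x * f x)"
  have cf: "continuous_on UNIV f" "continuous_on UNIV f'"
    using assms(1,2) has_vector_derivative_continuous by (metis continuous_at_imp_continuous_on)+
  have [measurable]: "f \<in> borel_measurable borel" "f'' \<in> borel_measurable borel"
    by (intro borel_measurable_continuous_onI cf assms)+
  have "(LINT x|lborel. fchar n x * f'' x) = (2 * pi * of_int n * \<i>) * ((2 * pi * of_int n * \<i>) * c)"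
    unfolding c_def using assms cf
    by (subst fourier_coefficient_derivative[of f' f'' B]; (subst fourier_coefficient_derivative[of f f' B])?; simp)
  moreover have "norm (LINT x|lborel. fchar n x * f'' x) \<le> B * W" "norm c \<le> B * W"
    unfolding W_def c_def by (rule integrable_decay(2); use b in \<open>simp add: norm_mult\<close>)+
  moreover have "norm (z * (z * c)) = (norm z)\<^sup>2 * norm c" for z
    by (simp add: norm_mult power2_eq_square)
  moreover have "(norm (2 * pi * of_int n * \<i>))\<^sup>2 = (2 * pi * of_int n)\<^sup>2"
    by (simp add: norm_mult power_mult_distrib)
  ultimately have "(2 * pi * of_int n)\<^sup>2 * norm c \<le> B * W"
    by metis
  moreover have "(of_int n)\<^sup>2 * norm c \<le> (2 * pi * of_int n)\<^sup>2 * norm c"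
  proof (intro mult_right_mono)
    have "1 * (of_int n :: real)\<^sup>2 \<le> (2 * pi)\<^sup>2 * (of_int n)\<^sup>2"
    proof (rule mult_right_mono)
      show "1 \<le> (2 * pi)\<^sup>2" using pi_gt3 by (intro one_le_power) linarith
    qed auto
    then show "(real_of_int n)\<^sup>2 \<le> (2 * pi * of_int n)\<^sup>2" by (simp add: power_mult_distrib)
  qed auto
  ultimately show ?thesis
    using \<open>norm c \<le> B * W\<close> unfolding c_def[symmetric] W_def[symmetric] by (simp add: distrib_right)
qed

text \<open>Every finite set of integers lies in a symmetric interval, so an unconditional sum can
  be identified from its symmetric partial sums, the ones that telescope below.\<close>

lemma has_sum_int_imp_tendsto:
  assumes "(f has_sum S) (UNIV :: int set)"
  shows "(\<lambda>N. \<Sum>m\<in>{- int N..int N}. f m) \<longlonglongrightarrow> S"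
proof -
  have "filterlim (\<lambda>N. {- int N..int N}) (finite_subsets_at_top UNIV) sequentially"
    unfolding filterlim_finite_subsets_at_top
  proof (intro allI impI)
    fix X :: "int set" assume "finite X \<and> X \<subseteq> UNIV"
    then have X: "finite X" by simp
    define K where "K = (\<Sum>x\<in>X. nat \<bar>x\<bar>)"
    have "X \<subseteq> {- int N..int N}" if "K \<le> N" for N
    proof
      fix x assume "x \<in> X"
      then have "nat \<bar>x\<bar> \<le> K" unfolding K_def using X by (intro member_le_sum) auto
      then show "x \<in> {- int N..int N}" using that by auto
    qed
    then show "\<forall>\<^sub>F N in sequentially. finite {- int N..int N} \<and> X \<subseteq> {- int N..int N} \<and> {- int N..int N} \<subseteq> UNIV"
      by (auto simp: eventually_sequentially)
  qed
  with assms show ?thesis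
    unfolding has_sum_def by (rule filterlim_compose)
qed

section \<open>Size of \<open>fchar 1 - 1\<close> and a Riemann-Lebesgue lemma\<close>

text \<open>Up to \<open>pi / 3\<close> the cosine is at least one half, so
  \<open>sin t - t / 2\<close> increases from zero. Beyond, the number \<open>4 / 5\<close>
  separates \<open>t / 2\<close>, at most \<open>pi / 4\<close>, from \<open>sin (pi / 3)\<close>,
  half the square root of 3.\<close>

lemma half_le_sin:
  assumes "0 \<le> t" "t \<le> pi / 2"
  shows "t / 2 \<le> sin t"
proof (cases "t \<le> pi / 3")
  case True
  have "sin 0 - 0 / 2 \<le> sin t - t / 2"
  proof (rule DERIV_nonneg_imp_nondecreasing[OF assms(1)])
    fix x :: real assume x: "0 \<le> x" "x \<le> t"
    have "cos (pi / 3) \<le> cos x"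
      using x True by (intro cos_monotone_0_pi_le) auto
    then have "0 \<le> cos x - 1 / 2" by (simp add: cos_60)
    moreover have "DERIV (\<lambda>x. sin x - x / 2) x :> cos x - 1 / 2"
      by (auto intro!: derivative_eq_intros)
    ultimately show "\<exists>y. DERIV (\<lambda>x. sin x - x / 2) x :> y \<and> 0 \<le> y" by blast
  qed
  then show ?thesis by simp
next
  case False
  have "t / 2 \<le> 4 / 5" using assms(2) pi_less_4 pi_approx by (simp add: field_simps)
  also have "4 / 5 \<le> sin (pi / 3)"
    unfolding sin_60 using real_le_rsqrt[of "8/5" 3] by (simp add: power2_eq_square)
  also have "\<dots> \<le> sin t"
    using False assms by (intro sin_monotone_2pi_le) auto
  finally show ?thesis .
qed

text \<open>\<open>fchar 1 x - 1\<close> has norm \<open>2 * \<bar>sin (pi * x)\<bar>\<close> and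
  thus vanishes only to first order at the endpoints. Dividing a Lipschitz function that vanishes at
  both endpoints by it leaves a bounded quotient.\<close>

lemma norm_fchar_diff_ge:
  assumes "0 \<le> x" "x \<le> 1"
  shows "min x (1 - x) \<le> norm (fchar 1 x - 1)"
proof -
  have "norm (fchar 1 x - 1) = norm (exp (\<i> * of_real (- (2 * pi * x))) - 1)"
    by (simp add: fchar_def cis_conv_exp)
  also have "\<dots> = 2 * \<bar>sin (pi * x)\<bar>"
    by (subst dist_exp_i_1) simp
  finally have *: "norm (fchar 1 x - 1) = 2 * \<bar>sin (pi * x)\<bar>" .
  have le: "y \<le> 2 * sin (pi * y)" if "0 \<le> y" "y \<le> 1 / 2" for y
  proof -
    have "y \<le> pi * y" using that(1) pi_gt3 by (intro mult_le_cancel_right1[THEN iffD2]) auto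
    also have "pi * y \<le> 2 * sin (pi * y)"
      using half_le_sin[of "pi * y"] that by (simp add: field_simps)
    finally show ?thesis .
  qed
  \<comment> \<open>The reflection about \<open>1 / 2\<close> reduces the right half of the interval
    to the left half, where \<open>le\<close> applies.\<close>
  have "sin (pi * (1 - x)) = sin (pi * x)"
    by (simp add: right_diff_distrib)
  then show ?thesis
    using le[of x] le[of "1 - x"] assms unfolding * by (cases "x \<le> 1 / 2") auto
qed

text \<open>Translating by half a period \<open>h = 1 / (2 k)\<close> flips the sign of the character, so the integral
  is bounded by the \<open>L\<^sup>1\<close> distance between \<open>G\<close> and its translate.\<close>

lemma riemann_lebesgue_unit_interval:
  fixes G :: "real \<Rightarrow> complex" and k :: "nat \<Rightarrow> int"
  assumes [measurable]: "G \<in> borel_measurable borel"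
    and bnd: "\<And>x. norm (G x) \<le> M" and supp: "\<And>x. x \<notin> {0..1} \<Longrightarrow> G x = 0"
    and cont: "\<And>x. x \<noteq> 0 \<Longrightarrow> x \<noteq> 1 \<Longrightarrow> isCont G x"
    and k0: "\<And>j. k j \<noteq> 0" and k: "(\<lambda>j. 1 / of_int (k j)) \<longlonglongrightarrow> (0 :: real)"
  shows "(\<lambda>j. LINT x|lborel. fchar (k j) x * G x) \<longlonglongrightarrow> 0"
proof -
  define h :: "nat \<Rightarrow> real" where "h = (\<lambda>j. 1 / of_int (k j) / 2)"
  define I where "I = (\<lambda>j. LINT x|lborel. fchar (k j) x * G x)"
  have M: "0 \<le> M" using bnd norm_ge_zero order_trans by blast
  have h: "h \<longlonglongrightarrow> 0" "\<bar>h j\<bar> \<le> 1" for j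
  proof -
    show "h \<longlonglongrightarrow> 0" unfolding h_def using tendsto_divide[OF k tendsto_const[of 2]] by simp
    have "1 \<le> \<bar>real_of_int (k j)\<bar>" using k0[of j] by linarith
    then show "\<bar>h j\<bar> \<le> 1" by (simp add: h_def field_simps)
  qed
  have fh: "fchar (k j) (x + h j) = - fchar (k j) x" for j x
  proof -
    have "fchar (k j) (h j) = cis (- pi)" using k0[of j] by (simp add: fchar_def h_def)
    also have "\<dots> = - 1" by (simp add: complex_eq_iff)
    finally show ?thesis by (simp add: fchar_add)
  qed
  \<comment> \<open>As \<open>\<bar>h j\<bar> \<le> 1\<close>, both \<open>G\<close> and its
    translate by \<open>h j\<close> vanish outside \<open>{-1..2}\<close>, so one dominating
    function serves for all \<open>j\<close>.\<close>
  have w: "integrable lborel (\<lambda>x::real. indicator {-1..2} x * (2 * M) :: real)"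
    by (intro integrable_mult_left integrable_real_indicator) auto
  have intG: "integrable lborel G"
    by (rule Bochner_Integration.integrable_bound[OF w]) (use bnd supp M in \<open>auto intro!: AE_I2 simp: indicator_def intro: order_trans[OF bnd]\<close>)
  have intGh: "integrable lborel (\<lambda>x. G (x + t))" for t
    using lborel_integrable_real_affine[OF intG, of 1 t] by (simp add: add.commute)
  have intf: "integrable lborel (\<lambda>x. fchar n x * g x)" if g: "integrable lborel g" for g n
    by (rule Bochner_Integration.integrable_bound[OF g]) (use borel_measurable_integrable[OF g] in \<open>auto simp: norm_mult\<close>)
  have le: "norm (I j) \<le> (LINT x|lborel. norm (G x - G (x + h j)))" for j
  proof -
    have "I j = (LINT x|lborel. fchar (k j) (x + h j) * G (x + h j))"
      using lborel_integral_real_affine[of 1 "\<lambda>x. fchar (k j) x * G x" "h j"]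
      by (simp add: I_def add.commute)
    \<comment> \<open>By \<open>fh\<close> the translated integral is \<open>I j\<close> again, but
      with the opposite sign in front of the character; averaging the two expressions produces the
      difference of \<open>G\<close> and its translate.\<close>
    then have "2 * I j = I j - (LINT x|lborel. fchar (k j) x * G (x + h j))"
      by (simp add: fh)
    also have "\<dots> = (LINT x|lborel. fchar (k j) x * (G x - G (x + h j)))"
      unfolding I_def by (simp add: right_diff_distrib intf intG intGh)
    also have "norm \<dots> \<le> (LINT x|lborel. norm (fchar (k j) x * (G x - G (x + h j))))"
      by (rule integral_norm_bound)
    finally have "2 * norm (I j) \<le> (LINT x|lborel. norm (G x - G (x + h j)))"
      by (simp add: norm_mult)
    then show ?thesis using norm_ge_zero[of "I j"] by linarith
  qed
  have lim: "(\<lambda>j. LINT x|lborel. norm (G x - G (x + h j))) \<longlonglongrightarrow> (LINT x|(lborel :: real measure). 0)"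
  proof (rule integral_dominated_convergence[OF _ _ w])
    \<comment> \<open>\<open>G\<close> may jump at the endpoints 0 and 1, which form a null
      set.\<close>
    have "AE x in lborel. x \<noteq> (0::real) \<and> x \<noteq> 1"
      using AE_lborel_singleton[of 0] AE_lborel_singleton[of 1] by (simp add: AE_conj_iff)
    then show "AE x in lborel. (\<lambda>j. norm (G x - G (x + h j))) \<longlonglongrightarrow> 0"
    proof eventually_elim
      case (elim x)
      then have "isCont G x" using cont by simp
      moreover have "(\<lambda>j. x + h j) \<longlonglongrightarrow> x"
        using tendsto_add[OF tendsto_const[of x] h(1)] by simp
      ultimately have "(\<lambda>j. G (x + h j)) \<longlonglongrightarrow> G x"
        by (rule isCont_tendsto_compose)
      then have "(\<lambda>j. norm (G x - G (x + h j))) \<longlonglongrightarrow> norm (G x - G x)"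
        by (intro tendsto_intros)
      then show ?case by simp
    qed
    show "AE x in lborel. norm (norm (G x - G (x + h j))) \<le> indicator {-1..2} x * (2 * M)" for j
    proof (rule AE_I2)
      fix x :: real
      show "norm (norm (G x - G (x + h j))) \<le> indicator {-1..2} x * (2 * M)"
      proof (cases "x \<in> {-1..2}")
        case True
        have "norm (G x - G (x + h j)) \<le> M + M"
          using norm_triangle_ineq4 add_mono[OF bnd bnd] by (rule order_trans)
        with True show ?thesis by simp
      next
        case False
        then have "x \<notin> {0..1}" "x + h j \<notin> {0..1}" using h(2)[of j] by auto
        then show ?thesis using supp by (simp add: M)
      qed
    qed
  qed measurable
  show ?thesis
    using Lim_null_comparison[OF always_eventually[OF allI[OF le]]] lim by (simp add: I_def)
qed

section \<open>Periodization and the Poisson formula\<close>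

text \<open>The intended instances are the rescaled slices of a two-variable Schwartz function with
  the first variable fixed. The derivatives and the common bound \<open>B\<close> are parameters so
  that each slice can supply its own \<open>B\<close>, decaying in the fixed variable.\<close>

locale decaying_C2 =
  fixes f f' f'' :: "real \<Rightarrow> complex" and B :: real
  assumes f: "\<And>x. (f has_vector_derivative f' x) (at x)"
    and f': "\<And>x. (f' has_vector_derivative f'' x) (at x)" and f'': "continuous_on UNIV f''"
    and b: "\<And>x. (1 + x\<^sup>2) * norm (f x) \<le> B" "\<And>x. (1 + x\<^sup>2) * norm (f' x) \<le> B"
      "\<And>x. (1 + x\<^sup>2) * norm (f'' x) \<le> B"
begin

definition periodization :: "real \<Rightarrow> complex" where
  "periodization x = (\<Sum>\<^sub>\<infinity>m::int. f (x + of_int m))"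

lemma f_measurable [measurable]: "f \<in> borel_measurable borel"
  by (intro borel_measurable_continuous_onI continuous_at_imp_continuous_on ballI
      has_vector_derivative_continuous[OF f])

text \<open>The affine comparison with offset \<open>x\<close> and step 1 has constant
  \<open>3 + 2 * x\<^sup>2\<close>, which is at most 5 on the unit interval.\<close>

lemma decay_on_unit_interval:
  assumes "\<And>x. (1 + x\<^sup>2) * norm (g x) \<le> B" "x \<in> {0..1}"
  shows "norm (g (x + of_int m)) \<le> 5 * B * (1 / (1 + (of_int m)\<^sup>2))"
proof -
  have "norm (g 0) \<le> B" using assms(1)[of 0] by simp
  then have B: "0 \<le> B" using norm_ge_zero[of "g 0"] by linarith
  have "1 + (of_int m)\<^sup>2 \<le> (1 + 2 * (1 + x\<^sup>2) / 1\<^sup>2) * (1 + (x + of_int m * 1)\<^sup>2)"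
    by (rule one_plus_square_affine_le) simp
  also have "\<dots> \<le> 5 * (1 + (x + of_int m)\<^sup>2)"
    using assms(2) by (intro mult_mono) (auto simp: power_le_one)
  finally have "(1 + (of_int m)\<^sup>2) * norm (g (x + of_int m)) \<le> 5 * (1 + (x + of_int m)\<^sup>2) * norm (g (x + of_int m))"
    by (rule mult_right_mono) simp
  also have "\<dots> \<le> 5 * B" using assms(1)[of "x + of_int m"] by (simp only: mult.assoc)
  finally show ?thesis by (simp add: pos_le_divide_eq mult.commute add_pos_nonneg)
qed

lemma summable_translates:
  assumes "x \<in> {0..1}"
  shows "(\<lambda>m::int. f (x + of_int m)) summable_on UNIV"
proof (rule abs_summable_summable, rule Infinite_Sum.abs_summable_on_comparison_test')
  show "(\<lambda>m::int. 5 * B * (1 / (1 + (of_int m)\<^sup>2))) summable_on UNIV"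
    by (intro summable_on_cmult_right summable_on_inverse_square_int)
qed (rule decay_on_unit_interval[OF b(1) assms])

text \<open>Because \<open>B\<close> bounds \<open>f\<close> and \<open>f'\<close> alike, this
  number serves twice: through \<open>f'\<close> it is a Lipschitz constant of the periodization,
  through \<open>f\<close> it dominates the partial sums of translates.\<close>

definition lipschitz_const :: real where
  "lipschitz_const = 5 * B * (\<Sum>\<^sub>\<infinity>m::int. 1 / (1 + (of_int m)\<^sup>2))"

text \<open>The mean value inequality for each translate, with the summable bound on
  \<open>f'\<close>. A Lipschitz estimate, rather than mere continuity, is what bounds Chernoff's
  quotient.\<close>

lemma periodization_lipschitz:
  assumes "x \<in> {0..1}" "y \<in> {0..1}"
  shows "norm (periodization x - periodization y) \<le> lipschitz_const * \<bar>x - y\<bar>"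
proof -
  have bound: "norm (f (x + of_int m) - f (y + of_int m)) \<le> 5 * B * (1 / (1 + (of_int m)\<^sup>2)) * norm (x - y)" for m
  proof (rule differentiable_bound[where S="{0..1}" and f="\<lambda>x. f (x + of_int m)" and f'="\<lambda>x h. h *\<^sub>R f' (x + of_int m)"])
    show "((\<lambda>x. f (x + of_int m)) has_derivative (\<lambda>h. h *\<^sub>R f' (x + of_int m))) (at x within {0..1})" for x
    proof -
      have "((\<lambda>x. f (x + of_int m)) has_derivative (\<lambda>h. (h + 0) *\<^sub>R f' (x + of_int m))) (at x within {0..1})"
        by (rule has_derivative_compose[OF has_derivative_add[OF has_derivative_ident has_derivative_const] f[unfolded has_vector_derivative_def]])
      then show ?thesis by simp
    qed
    show "onorm (\<lambda>h. h *\<^sub>R f' (x + of_int m)) \<le> 5 * B * (1 / (1 + (of_int m)\<^sup>2))" if "x \<in> {0..1}" for x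
    proof (rule onorm_le)
      fix h :: real
      show "norm (h *\<^sub>R f' (x + of_int m)) \<le> 5 * B * (1 / (1 + (of_int m)\<^sup>2)) * norm h"
        using mult_right_mono[OF decay_on_unit_interval[OF b(2) that], of "norm h" m]
        by (simp add: mult.commute[of "\<bar>h\<bar>"])
    qed
  qed (use assms in auto)
  have s: "(\<lambda>m::int. 5 * B * (1 / (1 + (of_int m)\<^sup>2)) * norm (x - y)) summable_on UNIV"
    by (intro summable_on_cmult_left summable_on_cmult_right summable_on_inverse_square_int)
  have n: "(\<lambda>m::int. norm (f (x + of_int m) - f (y + of_int m))) summable_on UNIV"
    by (rule Infinite_Sum.abs_summable_on_comparison_test'[OF s bound])
  have "periodization x - periodization y = (\<Sum>\<^sub>\<infinity>m::int. f (x + of_int m) - f (y + of_int m))"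
    unfolding periodization_def
    using infsum_add[OF summable_translates[OF assms(1)] summable_on_uminus[THEN iffD2, OF summable_translates[OF assms(2)]]]
    by (simp add: infsum_uminus)
  also have "norm \<dots> \<le> (\<Sum>\<^sub>\<infinity>m::int. norm (f (x + of_int m) - f (y + of_int m)))"
    by (rule norm_infsum_bound[OF n])
  also have "\<dots> \<le> (\<Sum>\<^sub>\<infinity>m::int. 5 * B * (1 / (1 + (of_int m)\<^sup>2)) * norm (x - y))"
    by (rule infsum_mono[OF n s bound])
  also have "\<dots> = lipschitz_const * \<bar>x - y\<bar>"
    by (simp add: lipschitz_const_def infsum_cmult_left' infsum_cmult_right' del: times_divide_eq_right)
  finally show ?thesis .
qed

lemma periodization_1: "periodization 1 = periodization 0"
  unfolding periodization_def
  by (rule infsum_reindex_bij_witness[of _ "\<lambda>m. m - 1" "\<lambda>m. m + 1"]) (auto simp: algebra_simps)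

lemma continuous_on_periodization: "continuous_on {0..1} periodization"
  unfolding continuous_on_iff
proof (intro ballI allI impI)
  fix x :: real and e :: real assume x: "x \<in> {0..1}" and e: "0 < e"
  define d where "d = e / (\<bar>lipschitz_const\<bar> + 1)"
  have "dist (periodization y) (periodization x) < e" if y: "y \<in> {0..1}" "dist y x < d" for y
  proof -
    have "dist (periodization y) (periodization x) \<le> lipschitz_const * \<bar>y - x\<bar>"
      using periodization_lipschitz[OF y(1) x] by (simp add: dist_norm)
    also have "\<dots> \<le> (\<bar>lipschitz_const\<bar> + 1) * \<bar>y - x\<bar>"
      by (intro mult_right_mono) auto
    also have "\<dots> < (\<bar>lipschitz_const\<bar> + 1) * d"
      using y(2) by (intro mult_strict_left_mono) (auto simp: dist_norm)
    also have "\<dots> = e" by (simp add: d_def add_nonneg_pos)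
    finally show ?thesis .
  qed
  moreover have "0 < d" using e by (simp add: d_def)
  ultimately show "\<exists>d>0. \<forall>y\<in>{0..1}. dist y x < d \<longrightarrow> dist (periodization y) (periodization x) < e"
    by blast
qed

text \<open>The line is cut into cells \<open>[m, m + 1)\<close> and each is moved back to the unit
  cell, which leaves the 1-periodic character unchanged. Dominated convergence treats the integrals
  before and after the move.\<close>

lemma fourier_coefficient_unfold:
  "(LINT x|lborel. fchar n x * f x) =
    (LINT x|lborel. indicator {0..<1} x *\<^sub>R (fchar n x * periodization x))"
proof -
  define g where "g = (\<lambda>x. fchar n x * f x)"
  have [measurable]: "g \<in> borel_measurable borel" unfolding g_def by measurable
  have intg: "integrable lborel g"
    unfolding g_def by (rule integrable_decay(1)[where B=B]; simp add: norm_mult b)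
  \<comment> \<open>\<open>A N\<close> restricts \<open>g\<close> to the cells from
    \<open>-N\<close> to \<open>N\<close>; \<open>C N\<close> is the same finite sum with every cell
    translated to the unit cell, so the two have equal integrals.\<close>
  define A where "A = (\<lambda>N x. \<Sum>m\<in>{- int N..int N}. indicator {0..<1} (x - of_int m) *\<^sub>R g x)"
  define C where "C = (\<lambda>N x. \<Sum>m\<in>{- int N..int N}. indicator {0..<1} x *\<^sub>R g (x + of_int m))"
  have [measurable]: "A N \<in> borel_measurable borel" "C N \<in> borel_measurable borel" for N
    unfolding A_def C_def by measurable
  have A_eq: "A N x = (if \<lfloor>x\<rfloor> \<in> {- int N..int N} then g x else 0)" for N x
  proof -
    have "(indicator {0..<1} (x - of_int m) :: real) = (if m = \<lfloor>x\<rfloor> then 1 else 0)" for m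
      by (auto simp: indicator_def floor_unique floor_eq_iff; linarith)
    then have "A N x = (\<Sum>m\<in>{- int N..int N}. if m = \<lfloor>x\<rfloor> then g x else 0)"
      unfolding A_def by (intro sum.cong) auto
    then show ?thesis by simp
  qed
  have limA: "(\<lambda>N. LINT x|lborel. A N x) \<longlonglongrightarrow> (LINT x|lborel. g x)"
  proof (rule integral_dominated_convergence[OF _ _ integrable_norm[OF intg]])
    show "AE x in lborel. (\<lambda>N. A N x) \<longlonglongrightarrow> g x"
    proof (rule AE_I2)
      fix x
      have "A N x = g x" if "nat \<bar>\<lfloor>x\<rfloor>\<bar> \<le> N" for N
        using that unfolding A_eq by auto
      then show "(\<lambda>N. A N x) \<longlonglongrightarrow> g x"
        by (intro tendsto_eventually) (auto simp: eventually_sequentially)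
    qed
    show "AE x in lborel. norm (A N x) \<le> norm (g x)" for N
      by (simp add: A_eq)
  qed measurable
  have intAg: "integrable lborel (\<lambda>x. indicator {0..<1} (x - of_int m) *\<^sub>R g x)" for m
    by (rule Bochner_Integration.integrable_bound[OF intg]) (auto simp: indicator_def)
  have AC: "(LINT x|lborel. A N x) = (LINT x|lborel. C N x)" for N
  proof -
    have i: "integrable lborel (\<lambda>x. indicator {0..<1} x *\<^sub>R g (x + of_int m))" for m
      using lborel_integrable_real_affine[OF intAg[of m], of 1 "of_int m"] by (simp add: add.commute)
    have "(LINT x|lborel. indicator {0..<1} (x - of_int m) *\<^sub>R g x) = (LINT x|lborel. indicator {0..<1} x *\<^sub>R g (x + of_int m))" for m
      using lborel_integral_real_affine[of 1 "\<lambda>x. indicator {0..<1} (x - of_int m) *\<^sub>R g x" "of_int m"]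
      by (simp add: add.commute)
    then show ?thesis
      unfolding A_def C_def
      by (subst (1 2) Bochner_Integration.integral_sum) (simp_all add: i intAg)
  qed
  have limC: "(\<lambda>N. LINT x|lborel. C N x) \<longlonglongrightarrow> (LINT x|lborel. indicator {0..<1} x *\<^sub>R (fchar n x * periodization x))"
  proof (rule integral_dominated_convergence[where w="\<lambda>x. indicator {0..<1} x * \<bar>lipschitz_const\<bar>"])
    \<comment> \<open>Continuity of the periodization is established on the closed interval, so
      measurability is obtained there and then cut down to the half-open cell.\<close>
    have "(\<lambda>x. indicator {0..1} x *\<^sub>R periodization x) \<in> borel_measurable borel"
      by (rule borel_measurable_continuous_on_indicator[OF _ continuous_on_periodization]) simp
    then have "(\<lambda>x. indicator {0..<1} x *\<^sub>R (fchar n x * (indicator {0..1} x *\<^sub>R periodization x))) \<in> borel_measurable borel"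
      by measurable
    also have "(\<lambda>x. indicator {0..<1} x *\<^sub>R (fchar n x * (indicator {0..1} x *\<^sub>R periodization x)))
        = (\<lambda>x. indicator {0..<1} x *\<^sub>R (fchar n x * periodization x))"
      by (auto simp: indicator_def)
    finally show "(\<lambda>x. indicator {0..<1} x *\<^sub>R (fchar n x * periodization x)) \<in> borel_measurable lborel"
      by simp
    have C_eq: "C N x = indicator {0..<1} x *\<^sub>R (fchar n x * (\<Sum>m\<in>{- int N..int N}. f (x + of_int m)))" for N x
      by (simp add: C_def g_def fchar_add sum_distrib_left scaleR_sum_right)
    show "AE x in lborel. (\<lambda>N. C N x) \<longlonglongrightarrow> indicator {0..<1} x *\<^sub>R (fchar n x * periodization x)"
    proof (rule AE_I2)
      fix x :: real
      show "(\<lambda>N. C N x) \<longlonglongrightarrow> indicator {0..<1} x *\<^sub>R (fchar n x * periodization x)"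
      proof (cases "x \<in> {0..<1}")
        case True
        then have "(\<lambda>N. \<Sum>m\<in>{- int N..int N}. f (x + of_int m)) \<longlonglongrightarrow> periodization x"
          unfolding periodization_def
          by (intro has_sum_int_imp_tendsto has_sum_infsum summable_translates) auto
        then show ?thesis unfolding C_eq by (intro tendsto_intros)
      qed (simp add: C_eq)
    qed
    show "AE x in lborel. norm (C N x) \<le> indicator {0..<1} x * \<bar>lipschitz_const\<bar>" for N
    proof (rule AE_I2)
      fix x :: real
      show "norm (C N x) \<le> indicator {0..<1} x * \<bar>lipschitz_const\<bar>"
      proof (cases "x \<in> {0..<1}")
        case True
        then have x: "x \<in> {0..1}" by auto
        have "norm (f 0) \<le> B" using b(1)[of 0] by simp
        then have B: "0 \<le> B" using norm_ge_zero[of "f 0"] by linarith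
        have "norm (C N x) \<le> (\<Sum>m\<in>{- int N..int N}. norm (f (x + of_int m)))"
          using True by (simp add: C_eq norm_mult norm_sum)
        also have "\<dots> \<le> (\<Sum>m\<in>{- int N..int N}. 5 * B * (1 / (1 + (of_int m)\<^sup>2)))"
          by (intro sum_mono decay_on_unit_interval[OF b(1) x])
        also have "\<dots> = 5 * B * (\<Sum>m\<in>{- int N..int N}. 1 / (1 + (of_int m)\<^sup>2))"
          by (simp only: sum_distrib_left)
        also have "\<dots> \<le> lipschitz_const"
          unfolding lipschitz_const_def using B
          by (intro mult_left_mono finite_sum_le_infsum summable_on_inverse_square_int) auto
        finally show ?thesis using True by simp
      qed (simp add: C_eq)
    qed
    show "integrable lborel (\<lambda>x::real. indicator {0..<1} x * \<bar>lipschitz_const\<bar>)"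
      by (intro integrable_mult_left integrable_real_indicator) auto
  qed measurable
  show ?thesis
    using LIMSEQ_unique[OF limA] limC unfolding AC g_def by blast
qed

lemma integral_fchar_unit_interval:
  "(LINT x|lborel. indicator {0..<1} x *\<^sub>R fchar n x) = (if n = 0 then 1 else 0)"
proof -
  have "(LINT x|lborel. indicator {0..<1} x *\<^sub>R fchar n x) = (LINT x|lborel. indicator {0..1} x *\<^sub>R fchar n x)"
  proof (rule integral_cong_AE)
    show "AE x in lborel. indicator {0..<1} x *\<^sub>R fchar n x = indicator {0..1} x *\<^sub>R fchar n x"
      using AE_lborel_singleton[of "1::real"] by eventually_elim (auto simp: indicator_def)
  qed measurable
  also have "\<dots> = (if n = 0 then 1 else 0)"
  proof (cases "n = 0")
    case False
    define a where "a = - (2 * pi * of_int n * \<i>)"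
    have a: "a \<noteq> 0" using False by (simp add: a_def)
    have "(LINT x|lborel. indicator {0..1} x *\<^sub>R fchar n x) = fchar n 1 / a - fchar n 0 / a"
    proof (rule integral_FTC_Icc)
      show "((\<lambda>x. fchar n x / a) has_vector_derivative fchar n x) (at x within {0..1})" for x
        using has_vector_derivative_mult_right[OF fchar_has_vector_derivative[of n x "{0..1}"], of "1 / a"] a
        by (simp add: a_def)
    qed (auto intro: continuous_on_fchar)
    also have "\<dots> = 0" using fchar_of_int[of n 1] by simp
    finally show ?thesis using False by simp
  qed simp
  finally show ?thesis .
qed

text \<open>Chernoff's argument: with \<open>F\<close> the periodization and \<open>G = (F - F 0) / (fchar 1 - 1)\<close>, which is
  bounded because \<open>F\<close> is Lipschitz, the Fourier coefficients of \<open>F - F 0\<close> are differences of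
  consecutive coefficients of \<open>G\<close>; the symmetric partial sums telescope and the boundary terms
  vanish by the Riemann-Lebesgue lemma.\<close>

lemma poisson_summation:
  "((\<lambda>n. LINT x|lborel. fchar n x * f x) has_sum (\<Sum>\<^sub>\<infinity>m::int. f (of_int m))) UNIV"
proof -
  define F where "F = periodization"
  define c where "c = (\<lambda>n. LINT x|lborel. fchar n x * f x)"
  define G where "G = (\<lambda>x. indicator {0<..<1} x *\<^sub>R ((F x - F 0) / (fchar 1 x - 1)))"
  define g where "g = (\<lambda>n. LINT x|lborel. fchar n x * G x)"
  define K where "K = \<bar>lipschitz_const\<bar>"
  have contF: "continuous_on {0..1} F" unfolding F_def by (rule continuous_on_periodization)
  have ge: "min x (1 - x) \<le> norm (fchar 1 x - 1)" "0 < min x (1 - x)" "fchar 1 x \<noteq> 1" if "x \<in> {0<..<1}" for x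
  proof -
    show 1: "min x (1 - x) \<le> norm (fchar 1 x - 1)" "0 < min x (1 - x)"
      using that norm_fchar_diff_ge[of x] by auto
    then show "fchar 1 x \<noteq> 1" by auto
  qed
  \<comment> \<open>The Lipschitz estimate is taken from either endpoint;
    \<open>periodization_1\<close> makes \<open>F - F 0\<close> vanish at 1 as well.\<close>
  have Fle: "norm (F x - F 0) \<le> K * min x (1 - x)" if "x \<in> {0..1}" for x
  proof -
    have "norm (F x - F 0) \<le> lipschitz_const * \<bar>x\<bar>" "norm (F x - F 0) \<le> lipschitz_const * \<bar>x - 1\<bar>"
      using periodization_lipschitz[of x 0] periodization_lipschitz[of x 1] that periodization_1
      by (auto simp: F_def)
    moreover have "lipschitz_const * y \<le> K * y" if "0 \<le> y" for y
      using that by (intro mult_right_mono) (auto simp: K_def)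
    ultimately show ?thesis
      using that by (auto simp: min_def intro: order_trans)
  qed
  have contG: "continuous_on {0<..<1} (\<lambda>x. (F x - F 0) / (fchar 1 x - 1))"
    using ge(3) by (intro continuous_intros continuous_on_subset[OF contF]) auto
  have suppG: "G x = 0" if "x \<notin> {0..1}" for x
    using that by (auto simp: G_def)
  have G_measurable [measurable]: "G \<in> borel_measurable borel"
    unfolding G_def by (rule borel_measurable_continuous_on_indicator[OF _ contG]) simp
  have bndG: "norm (G x) \<le> K" for x
  proof (cases "x \<in> {0<..<1}")
    case True
    have "norm (F x - F 0) \<le> K * norm (fchar 1 x - 1)"
      using Fle[of x] mult_left_mono[OF ge(1)[OF True], of K] True by (auto simp: K_def)
    then show ?thesis
      using True ge(3)[OF True] by (simp add: G_def norm_divide pos_divide_le_eq)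
  qed (simp add: G_def K_def)
  have Gcont: "isCont G x" if "x \<noteq> 0" "x \<noteq> 1" for x
  proof (cases "x \<in> {0<..<1}")
    case True
    have ev: "\<forall>\<^sub>F y in nhds x. G y = (F y - F 0) / (fchar 1 y - 1)"
      using eventually_nhds_in_open[of "{0<..<1}" x] True by (auto elim!: eventually_mono simp: G_def)
    show ?thesis
      unfolding isCont_cong[OF ev] using contG True by (simp add: continuous_on_eq_continuous_at)
  next
    case False
    have "open (- {0..1::real})" by (simp add: open_Compl)
    from eventually_nhds_in_open[OF this, of x] False that
    have ev: "\<forall>\<^sub>F y in nhds x. G y = 0"
      by (auto elim!: eventually_mono simp: G_def)
    show ?thesis
      unfolding isCont_cong[OF ev] by simp
  qed
  have w: "integrable lborel (\<lambda>x::real. indicator {0..1} x * K :: real)"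
    by (intro integrable_mult_left integrable_real_indicator) auto
  have intG: "integrable lborel (\<lambda>x. fchar n x * G x)" for n
  proof (rule Bochner_Integration.integrable_bound[OF w], measurable, rule AE_I2)
    have "norm (G x) \<le> norm (indicator {0..1} x * K)" for x
      using bndG[of x] by (cases "x \<in> {0..1}") (auto simp: K_def G_def)
    then show "norm (fchar n x * G x) \<le> norm (indicator {0..1} x * K)" for x
      by (simp add: norm_mult)
  qed
  have ifc: "integrable lborel (\<lambda>x. indicator {0..<1} x *\<^sub>R fchar n x)" for n
  proof (rule Bochner_Integration.integrable_bound[where f="indicator {0..1} :: real \<Rightarrow> real"])
    show "AE x in lborel. norm (indicator {0..<1} x *\<^sub>R fchar n x) \<le> norm (indicator {0..1} x :: real)"
      by (rule AE_I2) (auto simp: indicator_def)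
  qed auto
  have c_eq: "c n = g (n + 1) - g n + (if n = 0 then F 0 else 0)" for n
  proof -
    have "c n = (LINT x|lborel. indicator {0..<1} x *\<^sub>R (fchar n x * F x))"
      unfolding c_def F_def by (rule fourier_coefficient_unfold)
    also have "\<dots> = (LINT x|lborel. (fchar (n + 1) x * G x - fchar n x * G x) + F 0 * (indicator {0..<1} x *\<^sub>R fchar n x))"
    proof (rule Bochner_Integration.integral_cong[OF refl])
      fix x :: real
      have "fchar (n + 1) x * G x - fchar n x * G x = fchar n x * ((fchar 1 x - 1) * G x)"
        by (simp only: fchar_Suc) (simp add: algebra_simps)
      \<comment> \<open>At \<open>x = 0\<close> the indicator sets \<open>G\<close> to zero, and
        \<open>F x - F 0\<close> is zero too, so the identity holds on the whole half-open
        cell.\<close>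
      also have "(fchar 1 x - 1) * G x = indicator {0..<1} x *\<^sub>R (F x - F 0)"
        using ge(3)[of x] by (cases "x = 0") (auto simp: G_def indicator_def)
      finally show "indicator {0..<1} x *\<^sub>R (fchar n x * F x) =
          (fchar (n + 1) x * G x - fchar n x * G x) + F 0 * (indicator {0..<1} x *\<^sub>R fchar n x)"
        by (simp add: algebra_simps indicator_def)
    qed
    also have "\<dots> = g (n + 1) - g n + F 0 * (if n = 0 then 1 else 0)"
      unfolding g_def integral_fchar_unit_interval[symmetric]
      by (simp only: Bochner_Integration.integral_add Bochner_Integration.integral_diff integral_mult_right_zero
          Bochner_Integration.integrable_diff integrable_mult_right intG ifc)
    finally show ?thesis by simp
  qed
  have partial_sums: "(\<Sum>n\<in>{- int N..int N}. c n) = g (int N + 1) - g (- int N) + F 0" for N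
  proof (induction N)
    case (Suc N)
    have "{- int (Suc N)..int (Suc N)} = insert (int (Suc N)) (insert (- int (Suc N)) {- int N..int N})"
      by auto
    then show ?case
      using Suc by (simp add: c_eq[of "1 + int N"] c_eq[of "- 1 - int N"] add.commute)
  qed (simp add: c_eq)
  have "(\<lambda>N. g (int N + 1)) \<longlonglongrightarrow> 0"
    unfolding g_def
  proof (rule riemann_lebesgue_unit_interval[OF G_measurable bndG suppG Gcont])
    show "(\<lambda>N. 1 / real_of_int (int N + 1)) \<longlonglongrightarrow> 0"
      using LIMSEQ_inverse_real_of_nat by (simp add: inverse_eq_divide add.commute)
  qed auto
  \<comment> \<open>Starting at the successor avoids frequency zero, to which the Riemann-Lebesgue
    lemma does not apply.\<close>
  moreover have "(\<lambda>N. g (- int N)) \<longlonglongrightarrow> 0"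
  proof (rule LIMSEQ_imp_Suc)
    show "(\<lambda>N. g (- int (Suc N))) \<longlonglongrightarrow> 0"
      unfolding g_def
    proof (rule riemann_lebesgue_unit_interval[OF G_measurable bndG suppG Gcont])
      show "(\<lambda>N. 1 / real_of_int (- int (Suc N))) \<longlonglongrightarrow> 0"
      proof -
        have "1 / real_of_int (- int (Suc N)) = - inverse (real (Suc N))" for N
          by (simp only: of_int_minus of_int_of_nat_eq) (simp add: inverse_eq_divide del: of_nat_Suc)
        then show ?thesis using tendsto_minus[OF LIMSEQ_inverse_real_of_nat] by (simp only: minus_zero)
      qed
    qed auto
  qed
  ultimately have "(\<lambda>N. g (int N + 1) - g (- int N) + F 0) \<longlonglongrightarrow> 0 - 0 + F 0"
    by (intro tendsto_intros)
  then have lim: "(\<lambda>N. \<Sum>n\<in>{- int N..int N}. c n) \<longlonglongrightarrow> F 0"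
    by (simp add: partial_sums)
  \<comment> \<open>Symmetric partial sums alone would give only a principal-value statement; the
    quadratic decay of the coefficients makes the sum unconditional.\<close>
  have "c summable_on UNIV"
  proof (rule abs_summable_summable, rule Infinite_Sum.abs_summable_on_comparison_test')
    let ?K = "2 * B * (LINT x|lborel. 1 / (1 + x\<^sup>2 :: real))"
    show "(\<lambda>n::int. ?K * (1 / (1 + (of_int n)\<^sup>2))) summable_on UNIV"
      by (intro summable_on_cmult_right summable_on_inverse_square_int)
    show "norm (c n) \<le> ?K * (1 / (1 + (of_int n)\<^sup>2))" for n
      using fourier_coefficient_decay[OF f f' f'' b, of n]
      by (simp add: c_def pos_le_divide_eq mult.commute add_pos_nonneg)
  qed
  then have hs: "(c has_sum (\<Sum>\<^sub>\<infinity>n. c n)) UNIV"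
    by (rule has_sum_infsum)
  have "(\<Sum>\<^sub>\<infinity>n. c n) = F 0"
    using has_sum_int_imp_tendsto[OF hs] lim by (rule LIMSEQ_unique)
  also have "F 0 = (\<Sum>\<^sub>\<infinity>m::int. f (of_int m))"
    by (simp add: F_def periodization_def)
  finally show ?thesis using hs by (simp add: c_def)
qed

end

section \<open>The ZAK representation of the impulse train\<close>

definition zak_char :: "real \<Rightarrow> int \<Rightarrow> real \<Rightarrow> complex" where
  "zak_char T n \<nu> = exp (- \<i> * of_real (2 * pi * of_int n * \<nu> * T))"

definition zak_coeff :: "real \<Rightarrow> (real \<times> real \<Rightarrow> complex) \<Rightarrow> real \<Rightarrow> int \<Rightarrow> complex" where
  "zak_coeff T \<Phi> x n = (LINT \<nu>|lborel. zak_char T n \<nu> * \<Phi> (x, \<nu>))"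

lemma zak_term_eq: "zak_term T p n \<Phi> = p (\<lambda>t. zak_coeff T \<Phi> (t - of_int n * T) n)"
  by (simp add: zak_term_def dist_tensor_def dist_shift_def dist_of_fun_def zak_coeff_def zak_char_def)

lemma norm_zak_char [simp]: "norm (zak_char T n \<nu>) = 1"
  unfolding zak_char_def by (metis norm_exp_i_times mult_minus_left mult_minus_right of_real_minus)

lemma zak_char_measurable [measurable]: "zak_char T n \<in> borel_measurable borel"
  unfolding zak_char_def[abs_def] by (intro borel_measurable_continuous_onI continuous_intros)

lemma schwartz_zak_coeff:
  assumes "\<Phi> \<in> schwartz"
  shows "(\<lambda>x. zak_coeff T \<Phi> x n) \<in> schwartz"
  unfolding zak_coeff_def by (rule schwartz_partial_integral[OF assms]) auto

text \<open>Substituting \<open>\<nu> = a + u / T\<close> turns the frequency \<open>n T\<close>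
  into the integer frequency \<open>n\<close> of the Poisson formula; the offset \<open>a\<close>
  becomes a constant phase.\<close>

lemma zak_char_affine:
  assumes "0 < T"
  shows "zak_char T n (a + u / T) = zak_char T n a * fchar n u"
proof -
  have "2 * pi * of_int n * (a + u / T) * T = 2 * pi * of_int n * a * T + 2 * pi * of_int n * u"
    using assms by (simp add: field_simps)
  then show ?thesis
    by (simp only: zak_char_def fchar_def cis_conv_exp flip: exp_add) (simp add: algebra_simps)
qed

lemma zak_coeff_affine:
  assumes T: "0 < T"
  shows "zak_coeff T \<Phi> x n = zak_char T n a / T * (LINT u|lborel. fchar n u * \<Phi> (x, a + u / T))"
proof -
  have "zak_coeff T \<Phi> x n = \<bar>1 / T\<bar> *\<^sub>R (LINT u|lborel. zak_char T n (a + 1 / T * u) * \<Phi> (x, a + 1 / T * u))"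
    unfolding zak_coeff_def using T by (intro lborel_integral_real_affine) simp
  also have "(\<lambda>u. zak_char T n (a + 1 / T * u) * \<Phi> (x, a + 1 / T * u))
      = (\<lambda>u. zak_char T n a * (fchar n u * \<Phi> (x, a + u / T)))"
    using zak_char_affine[OF T, of n a] by (simp add: mult.assoc)
  finally show ?thesis
    using T by (simp add: scaleR_conv_of_real)
qed

text \<open>The function \<open>u \<mapsto> \<Phi> (x, a + u / T)\<close> is an instance of
  \<open>decaying_C2\<close> whose constant is a multiple of \<open>1 / (1 + x\<^sup>2)\<close>. The
  same instance yields the joint decay and the Poisson formula; the exponential cancels the phase
  \<open>zak_char T n a\<close> of the offset.\<close>

lemma zak_coeff_poisson:
  fixes \<Phi> :: "real \<times> real \<Rightarrow> complex"
  assumes T: "0 < T" and \<Phi>: "\<Phi> \<in> schwartz"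
  obtains D where "\<And>x n. (1 + x\<^sup>2) * ((1 + (of_int n)\<^sup>2) * norm (zak_coeff T \<Phi> x n)) \<le> D"
    and "\<And>x. ((\<lambda>n. exp (\<i> * of_real (2 * pi * a * of_int n * T)) * (T * zak_coeff T \<Phi> x n)) has_sum
          (\<Sum>\<^sub>\<infinity>m::int. \<Phi> (x, a + of_int m / T))) UNIV"
proof -
  define \<Phi>1 where "\<Phi>1 = partial_deriv (0, 1) \<Phi>"
  define \<Phi>2 where "\<Phi>2 = partial_deriv (0, 1) \<Phi>1"
  have basis: "(0 :: real, 1 :: real) \<in> Basis" by (simp add: Basis_prod_def)
  have \<Phi>1: "\<Phi>1 \<in> schwartz" unfolding \<Phi>1_def by (rule schwartz_partial_deriv[OF \<Phi> basis])
  have \<Phi>2: "\<Phi>2 \<in> schwartz" unfolding \<Phi>2_def by (rule schwartz_partial_deriv[OF \<Phi>1 basis])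
  obtain C0 where C0: "\<And>x y. (1 + \<bar>x\<bar>) ^ 2 * ((1 + y\<^sup>2) * norm (\<Phi> (x, y))) \<le> C0"
    using schwartz_prod_decay[OF \<Phi>] by blast
  obtain C1 where C1: "\<And>x y. (1 + \<bar>x\<bar>) ^ 2 * ((1 + y\<^sup>2) * norm (\<Phi>1 (x, y))) \<le> C1"
    using schwartz_prod_decay[OF \<Phi>1] by blast
  obtain C2 where C2: "\<And>x y. (1 + \<bar>x\<bar>) ^ 2 * ((1 + y\<^sup>2) * norm (\<Phi>2 (x, y))) \<le> C2"
    using schwartz_prod_decay[OF \<Phi>2] by blast
  \<comment> \<open>By the chain rule the first and second \<open>u\<close>-derivatives of the slice
    carry factors \<open>1 / T\<close> and \<open>1 / T\<^sup>2\<close>; the maximum is a common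
    bound for all three functions.\<close>
  define C where "C = max C0 (max (C1 / T) (C2 / T\<^sup>2))"
  \<comment> \<open>This is the constant of \<open>one_plus_square_affine_le\<close> for step
    \<open>1 / T\<close>, converting decay in \<open>a + u / T\<close> into decay in
    \<open>u\<close>.\<close>
  define K where "K = 1 + 2 * (1 + a\<^sup>2) / (1 / T)\<^sup>2"
  define W where "W = (LINT x|lborel. 1 / (1 + x\<^sup>2 :: real))"
  have K: "0 \<le> K" by (simp add: K_def)
  have W: "0 \<le> W" unfolding W_def by (intro integral_nonneg_AE AE_I2) simp
  have bound: "(1 + u\<^sup>2) * norm (c * \<Psi> (x, a + u / T)) \<le> K * C / (1 + x\<^sup>2)"
    if \<Psi>: "\<And>x y. (1 + \<bar>x\<bar>) ^ 2 * ((1 + y\<^sup>2) * norm (\<Psi> (x, y))) \<le> C'" and c: "norm c * C' \<le> C"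
    for \<Psi> :: "real \<times> real \<Rightarrow> complex" and c C' x u
  proof -
    let ?y = "a + u / T"
    have "1 + u\<^sup>2 \<le> K * (1 + ?y\<^sup>2)"
      unfolding K_def using one_plus_square_affine_le[of "1 / T" u a] T by simp
    moreover have "1 + x\<^sup>2 \<le> (1 + \<bar>x\<bar>) ^ 2"
      by (rule one_plus_square_le_abs)
    ultimately have "(1 + x\<^sup>2) * (1 + u\<^sup>2) * norm (c * \<Psi> (x, ?y))
        \<le> (1 + \<bar>x\<bar>) ^ 2 * (K * (1 + ?y\<^sup>2)) * norm (c * \<Psi> (x, ?y))"
      by (intro mult_right_mono mult_mono) auto
    also have "\<dots> = K * (norm c * ((1 + \<bar>x\<bar>) ^ 2 * ((1 + ?y\<^sup>2) * norm (\<Psi> (x, ?y)))))"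
      by (simp add: norm_mult)
    also have "\<dots> \<le> K * (norm c * C')"
      using K by (intro mult_left_mono \<Psi>) auto
    also have "\<dots> \<le> K * C"
      using K c by (intro mult_left_mono)
    finally show ?thesis
      by (simp add: pos_le_divide_eq add_pos_nonneg mult_ac)
  qed
  have derivs: "((\<lambda>u. \<Psi> (x, a + u / T)) has_vector_derivative 1 / T * partial_deriv (0, 1) \<Psi> (x, a + u / T)) (at u)"
    if \<Psi>: "\<Psi> \<in> schwartz" for \<Psi> :: "real \<times> real \<Rightarrow> complex" and x u
  proof -
    have "((\<lambda>u. a + u / T) has_vector_derivative 1 / T) (at u)"
      using T by (auto intro!: derivative_eq_intros)
    from vector_diff_chain_at[OF this schwartz_snd_vector_derivative[OF \<Psi>]]
    show ?thesis by (simp add: o_def scaleR_conv_of_real)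
  qed
  have decaying: "decaying_C2 (\<lambda>u. \<Phi> (x, a + u / T)) (\<lambda>u. 1 / T * \<Phi>1 (x, a + u / T))
      (\<lambda>u. 1 / T\<^sup>2 * \<Phi>2 (x, a + u / T)) (K * C / (1 + x\<^sup>2))" for x
  proof
    show "((\<lambda>u. \<Phi> (x, a + u / T)) has_vector_derivative 1 / T * \<Phi>1 (x, a + u / T)) (at u)" for u
      unfolding \<Phi>1_def by (rule derivs[OF \<Phi>])
    show "((\<lambda>u. 1 / T * \<Phi>1 (x, a + u / T)) has_vector_derivative 1 / T\<^sup>2 * \<Phi>2 (x, a + u / T)) (at u)" for u
      using has_vector_derivative_mult_right[OF derivs[OF \<Phi>1, of x u], of "1 / T"]
      by (simp add: \<Phi>2_def power2_eq_square)
    show "continuous_on UNIV (\<lambda>u. 1 / T\<^sup>2 * \<Phi>2 (x, a + u / T))"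
      using T by (intro continuous_intros continuous_on_compose2[OF schwartz_continuous_on[OF \<Phi>2, of UNIV]]) auto
    show "(1 + u\<^sup>2) * norm (\<Phi> (x, a + u / T)) \<le> K * C / (1 + x\<^sup>2)" for u
      using bound[where c=1, OF C0] by (simp add: C_def)
    show "(1 + u\<^sup>2) * norm (1 / T * \<Phi>1 (x, a + u / T)) \<le> K * C / (1 + x\<^sup>2)" for u
      by (rule bound[OF C1]) (use T in \<open>simp add: C_def norm_divide\<close>)
    show "(1 + u\<^sup>2) * norm (1 / T\<^sup>2 * \<Phi>2 (x, a + u / T)) \<le> K * C / (1 + x\<^sup>2)" for u
      by (rule bound[OF C2]) (use T in \<open>simp add: C_def norm_divide norm_power\<close>)
  qed
  show ?thesis
  proof
    show "(1 + x\<^sup>2) * ((1 + (of_int n)\<^sup>2) * norm (zak_coeff T \<Phi> x n)) \<le> 2 * K * C * W / T" for x n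
    proof -
      interpret decaying_C2 "\<lambda>u. \<Phi> (x, a + u / T)" "\<lambda>u. 1 / T * \<Phi>1 (x, a + u / T)"
        "\<lambda>u. 1 / T\<^sup>2 * \<Phi>2 (x, a + u / T)" "K * C / (1 + x\<^sup>2)" by (rule decaying)
      have "(1 + (of_int n)\<^sup>2) * norm (LINT u|lborel. fchar n u * \<Phi> (x, a + u / T)) \<le> 2 * (K * C / (1 + x\<^sup>2)) * W"
        unfolding W_def by (rule fourier_coefficient_decay[OF f f' f'' b])
      then have "(1 + (of_int n)\<^sup>2) * norm (LINT u|lborel. fchar n u * \<Phi> (x, a + u / T)) \<le> 2 * K * C * W / (1 + x\<^sup>2)"
        by simp
      then have *: "(1 + x\<^sup>2) * ((1 + (of_int n)\<^sup>2) * norm (LINT u|lborel. fchar n u * \<Phi> (x, a + u / T))) \<le> 2 * K * C * W"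
        by (simp add: pos_le_divide_eq add_pos_nonneg mult.commute)
      have "norm (zak_coeff T \<Phi> x n) = norm (LINT u|lborel. fchar n u * \<Phi> (x, a + u / T)) / T"
        unfolding zak_coeff_affine[OF T, of _ x n a] using T by (simp add: norm_mult norm_divide)
      then show ?thesis using divide_right_mono[OF *, of T] T by simp
    qed
    show "((\<lambda>n. exp (\<i> * of_real (2 * pi * a * of_int n * T)) * (T * zak_coeff T \<Phi> x n)) has_sum
          (\<Sum>\<^sub>\<infinity>m::int. \<Phi> (x, a + of_int m / T))) UNIV" for x
    proof -
      interpret decaying_C2 "\<lambda>u. \<Phi> (x, a + u / T)" "\<lambda>u. 1 / T * \<Phi>1 (x, a + u / T)"
        "\<lambda>u. 1 / T\<^sup>2 * \<Phi>2 (x, a + u / T)" "K * C / (1 + x\<^sup>2)" by (rule decaying)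
      have "exp (\<i> * of_real (2 * pi * a * of_int n * T)) * (T * zak_coeff T \<Phi> x n)
          = (LINT u|lborel. fchar n u * \<Phi> (x, a + u / T))" for n
      proof -
        have "exp (\<i> * of_real (2 * pi * a * of_int n * T)) * zak_char T n a = 1"
          by (simp add: zak_char_def mult_ac flip: exp_add)
        then show ?thesis
          unfolding zak_coeff_affine[OF T, of _ x n a] using T by (simp flip: mult.assoc)
      qed
      then show ?thesis using poisson_summation by simp
    qed
  qed
qed

definition phase :: "real \<Rightarrow> real \<Rightarrow> int \<Rightarrow> complex" where
  "phase T \<nu> n = exp (\<i> * of_real (2 * pi * \<nu> * of_int n * T))"

lemma norm_phase [simp]: "norm (phase T \<nu> n) = 1"
  unfolding phase_def by (rule norm_exp_i_times)

lemma phase_add: "phase T \<nu> (m + n) = phase T \<nu> m * phase T \<nu> n"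
  by (simp add: phase_def algebra_simps flip: exp_add)

definition impulse_train :: "real \<Rightarrow> real \<Rightarrow> real \<Rightarrow> real functional" where
  "impulse_train T \<tau> \<nu> \<phi> = (\<Sum>\<^sub>\<infinity>n. (sqrt T * phase T \<nu> n) * \<phi> (\<tau> + of_int n * T))"

text \<open>The index is the pair \<open>(m, n)\<close> of the theorem: \<open>fst\<close> counts
  steps in \<open>\<nu>\<close>, \<open>snd\<close> counts steps in \<open>\<tau>\<close> and
  carries the phase.\<close>

definition impulse_lattice :: "real \<Rightarrow> real \<Rightarrow> real \<Rightarrow> (real \<times> real) functional" where
  "impulse_lattice T \<tau> \<nu> \<Phi> =
    (\<Sum>\<^sub>\<infinity>i. phase T \<nu> (snd i) * \<Phi> (\<tau> + of_int (snd i) * T, \<nu> + of_int (fst i) / T))"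

lemma impulse_train:
  assumes T: "0 < T"
  shows "tempered_distribution (impulse_train T \<tau> \<nu>)"
    and "dist_has_sum (\<lambda>n. dist_scale (sqrt T * phase T \<nu> n) (dirac (\<tau> + of_int n * T))) (impulse_train T \<tau> \<nu>) UNIV"
proof -
  have s: "(\<lambda>n. 1 / (1 + norm (\<tau> + of_int n * T)) ^ 2) summable_on UNIV"
  proof (rule summable_on_comparison_test[OF summable_on_inverse_square_affine[OF T, of \<tau>]])
    show "1 / (1 + norm (\<tau> + of_int n * T)) ^ 2 \<le> 1 / (1 + (\<tau> + of_int n * T)\<^sup>2)" for n
      unfolding real_norm_def
      by (rule divide_left_mono[OF one_plus_square_le_abs]) (auto simp: add_pos_nonneg)
  qed auto
  have "norm (complex_of_real (sqrt T) * phase T \<nu> n) \<le> sqrt T" for n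
    using T by (simp add: norm_mult)
  note * = tempered_point_sum[OF s this]
  show "tempered_distribution (impulse_train T \<tau> \<nu>)"
    using *(1) unfolding impulse_train_def[abs_def] .
  show "dist_has_sum (\<lambda>n. dist_scale (sqrt T * phase T \<nu> n) (dirac (\<tau> + of_int n * T))) (impulse_train T \<tau> \<nu>) UNIV"
    using *(2) unfolding impulse_train_def[abs_def] .
qed

text \<open>The weight exponent 4 is two plus two: \<open>(1 + norm (x, y)) ^ 4\<close> dominates
  \<open>(1 + y\<^sup>2) * (1 + x\<^sup>2)\<close>, so the weights are bounded by a product of two
  summable one-dimensional families.\<close>

lemma impulse_lattice:
  assumes T: "0 < T"
  shows "tempered_distribution (impulse_lattice T \<tau> \<nu>)"
    and "dist_has_sum (\<lambda>i. dist_scale (phase T \<nu> (snd i)) (dirac (\<tau> + of_int (snd i) * T, \<nu> + of_int (fst i) / T)))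
      (impulse_lattice T \<tau> \<nu>) UNIV"
proof -
  let ?a = "\<lambda>i :: int \<times> int. (\<tau> + of_int (snd i) * T, \<nu> + of_int (fst i) / T)"
  have "(\<lambda>(m, n). 1 / (1 + (\<nu> + of_int m * (1 / T))\<^sup>2) * (1 / (1 + (\<tau> + of_int n * T)\<^sup>2))) summable_on (UNIV \<times> UNIV)"
    by (intro summable_on_product summable_on_inverse_square_affine) (use T in auto)
  note s = this[unfolded UNIV_Times_UNIV]
  have s: "(\<lambda>i. 1 / (1 + norm (?a i)) ^ 4) summable_on UNIV"
  proof (rule summable_on_comparison_test[OF s])
    fix i :: "int \<times> int"
    obtain x y where xy: "?a i = (x, y)" by blast
    have "\<bar>x\<bar> \<le> norm (x, y)" "\<bar>y\<bar> \<le> norm (x, y)"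
      by (auto simp: norm_prod_def intro: real_le_rsqrt)
    then have "x\<^sup>2 \<le> (norm (x, y))\<^sup>2" "y\<^sup>2 \<le> (norm (x, y))\<^sup>2"
      using power_mono[of "\<bar>x\<bar>" _ 2] power_mono[of "\<bar>y\<bar>" _ 2] by auto
    moreover have "1 + (norm (x, y))\<^sup>2 \<le> (1 + norm (x, y))\<^sup>2"
      using one_plus_square_le_abs[of "norm (x, y)"] by simp
    ultimately have "(1 + y\<^sup>2) * (1 + x\<^sup>2) \<le> (1 + norm (x, y))\<^sup>2 * (1 + norm (x, y))\<^sup>2"
      by (intro mult_mono) auto
    also have "\<dots> = (1 + norm (x, y)) ^ 4" by (simp flip: power_add)
    finally have "1 / (1 + norm (x, y)) ^ 4 \<le> 1 / ((1 + y\<^sup>2) * (1 + x\<^sup>2))"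
      by (intro frac_le mult_pos_pos) (auto simp: add_pos_nonneg)
    then show "1 / (1 + norm (?a i)) ^ 4 \<le>
        (case i of (m, n) \<Rightarrow> 1 / (1 + (\<nu> + of_int m * (1 / T))\<^sup>2) * (1 / (1 + (\<tau> + of_int n * T)\<^sup>2)))"
      using xy by (auto simp: case_prod_beta)
  qed auto
  have "norm (phase T \<nu> (snd i)) \<le> 1" for i :: "int \<times> int" by simp
  note * = tempered_point_sum[OF s this]
  show "tempered_distribution (impulse_lattice T \<tau> \<nu>)"
    using *(1) unfolding impulse_lattice_def[abs_def] .
  show "dist_has_sum (\<lambda>i. dist_scale (phase T \<nu> (snd i)) (dirac (?a i))) (impulse_lattice T \<tau> \<nu>) UNIV"
    using *(2) unfolding impulse_lattice_def[abs_def] .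
qed

lemma impulse_train_has_zak:
  assumes T: "0 < T"
  shows "has_zak T (impulse_train T \<tau> \<nu>) (impulse_lattice T \<tau> \<nu>)"
  unfolding has_zak_def dist_has_sum_def
proof (intro conjI impulse_lattice[OF T] ballI)
  fix \<Phi> :: "real \<times> real \<Rightarrow> complex" assume \<Phi>: "\<Phi> \<in> schwartz"
  define x where "x = (\<lambda>l::int. \<tau> + of_int l * T)"
  define P where "P = (\<lambda>l. \<Sum>\<^sub>\<infinity>m::int. \<Phi> (x l, \<nu> + of_int m / T))"
  \<comment> \<open>\<open>q (l, n)\<close> is the contribution to the \<open>n\<close>-th ZAK term
    of the impulse that the shift moves to \<open>x l\<close>, namely impulse \<open>l + n\<close>;
    its phase is already split.\<close>
  define q where "q = (\<lambda>(l, n). phase T \<nu> l * (phase T \<nu> n * (T * zak_coeff T \<Phi> (x l) n)))"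
  define Z where "Z = (\<lambda>n. dist_scale (sqrt T) (zak_term T (impulse_train T \<tau> \<nu>) n) \<Phi>)"
  obtain D where D: "\<And>x n. (1 + x\<^sup>2) * ((1 + (of_int n)\<^sup>2) * norm (zak_coeff T \<Phi> x n)) \<le> D"
    and poisson: "\<And>x. ((\<lambda>n. phase T \<nu> n * (T * zak_coeff T \<Phi> x n)) has_sum
          (\<Sum>\<^sub>\<infinity>m::int. \<Phi> (x, \<nu> + of_int m / T))) UNIV"
    using zak_coeff_poisson[OF T \<Phi>, of \<nu>] unfolding phase_def by metis
  have "q summable_on UNIV \<times> UNIV"
  proof (rule abs_summable_summable, rule Infinite_Sum.abs_summable_on_comparison_test')
    show "(\<lambda>i. T * D * (\<lambda>(l, n). 1 / (1 + (\<tau> + of_int l * T)\<^sup>2) * (1 / (1 + (of_int n)\<^sup>2))) i) summable_on UNIV \<times> UNIV"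
      by (intro summable_on_cmult_right summable_on_product summable_on_inverse_square_affine
          summable_on_inverse_square_int T) auto
    show "norm (q i) \<le> T * D * (\<lambda>(l, n). 1 / (1 + (\<tau> + of_int l * T)\<^sup>2) * (1 / (1 + (of_int n)\<^sup>2))) i" for i
    proof -
      obtain l n where i: "i = (l, n)" by (cases i)
      have "norm (zak_coeff T \<Phi> (x l) n) \<le> D * (1 / (1 + (x l)\<^sup>2) * (1 / (1 + (of_int n)\<^sup>2)))"
        using D[of "x l" n] by (simp add: pos_le_divide_eq add_pos_nonneg mult_ac)
      from mult_left_mono[OF this, of T] T show ?thesis
        by (simp add: i q_def norm_mult x_def mult.assoc)
    qed
  qed
  then have q: "(q has_sum infsum q (UNIV \<times> UNIV)) (UNIV \<times> UNIV)"
    by (rule has_sum_infsum)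
  have rows: "((\<lambda>n. q (l, n)) has_sum phase T \<nu> l * P l) UNIV" for l
    unfolding q_def P_def prod.case by (rule has_sum_cmult_right[OF poisson])
  have columns: "((\<lambda>l. q (l, n)) has_sum Z n) UNIV" for n
  proof -
    have q_swap: "(\<lambda>(n, l). q (l, n)) summable_on UNIV \<times> UNIV"
      using q[unfolded has_sum_swap[of q]] by (auto simp: summable_on_def)
    have "(\<lambda>l. q (l, n)) summable_on UNIV"
      by (rule summable_on_SigmaD1[OF q_swap]) simp
    moreover have "Z n = (\<Sum>\<^sub>\<infinity>l. q (l, n))"
    proof -
      have "Z n = (\<Sum>\<^sub>\<infinity>k. T * phase T \<nu> k * zak_coeff T \<Phi> (\<tau> + of_int k * T - of_int n * T) n)"
        unfolding Z_def dist_scale_def zak_term_eq impulse_train_def infsum_cmult_right'[symmetric]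
        using T by (simp flip: mult.assoc of_real_mult)
      also have "\<dots> = (\<Sum>\<^sub>\<infinity>l. q (l, n))"
        by (rule infsum_reindex_bij_witness[of _ "\<lambda>l. l + n" "\<lambda>k. k - n"])
          (auto simp: q_def x_def algebra_simps simp flip: phase_add)
      finally show ?thesis .
    qed
    ultimately show ?thesis by simp
  qed
  have "((\<lambda>i. phase T \<nu> (snd i) * \<Phi> (\<tau> + of_int (snd i) * T, \<nu> + of_int (fst i) / T)) has_sum impulse_lattice T \<tau> \<nu> \<Phi>) (UNIV \<times> UNIV)"
    using impulse_lattice(2)[OF T, of \<nu> \<tau>] \<Phi> by (simp add: dist_has_sum_def dist_scale_def dirac_def)
  \<comment> \<open>The lattice is indexed with the \<open>\<nu>\<close> step first; swapping puts
    \<open>l\<close> first, so that both double sums are evaluated through the same row sums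
    \<open>phase T \<nu> l * P l\<close>.\<close>
  then have "((\<lambda>(l, m). phase T \<nu> l * \<Phi> (x l, \<nu> + of_int m / T)) has_sum impulse_lattice T \<tau> \<nu> \<Phi>) (UNIV \<times> UNIV)"
    unfolding has_sum_swap[of "\<lambda>i. phase T \<nu> (snd i) * \<Phi> (\<tau> + of_int (snd i) * T, \<nu> + of_int (fst i) / T)"]
    by (simp add: x_def)
  note lattice = this
  have "((\<lambda>m. phase T \<nu> l * \<Phi> (x l, \<nu> + of_int m / T)) has_sum phase T \<nu> l * P l) UNIV" for l
  proof -
    have "(\<lambda>m. phase T \<nu> l * \<Phi> (x l, \<nu> + of_int m / T)) summable_on UNIV"
      using summable_on_SigmaD1[of "\<lambda>l m. phase T \<nu> l * \<Phi> (x l, \<nu> + of_int m / T)" UNIV "\<lambda>_. UNIV" l] lattice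
      by (auto simp: summable_on_def)
    then show ?thesis
      using has_sum_infsum by (fastforce simp: P_def infsum_cmult_right')
  qed
  then have "((\<lambda>l. phase T \<nu> l * P l) has_sum impulse_lattice T \<tau> \<nu> \<Phi>) UNIV"
    using has_sum_SigmaD[OF lattice, of "\<lambda>l. phase T \<nu> l * P l"] by simp
  moreover have "((\<lambda>l. phase T \<nu> l * P l) has_sum infsum q (UNIV \<times> UNIV)) UNIV"
    using has_sum_SigmaD[OF q, of "\<lambda>l. phase T \<nu> l * P l"] rows by simp
  ultimately have "infsum q (UNIV \<times> UNIV) = impulse_lattice T \<tau> \<nu> \<Phi>"
    using has_sum_unique by blast
  moreover have "(Z has_sum infsum q (UNIV \<times> UNIV)) UNIV"
    using has_sum_SigmaD[OF q[unfolded has_sum_swap[of q]], of Z] columns by simp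
  ultimately show "((\<lambda>n. dist_scale (sqrt T) (zak_term T (impulse_train T \<tau> \<nu>) n) \<Phi>) has_sum impulse_lattice T \<tau> \<nu> \<Phi>) UNIV"
    by (simp add: Z_def)
qed

text \<open>In every ZAK term the signal is applied to a translate of a \<open>zak_coeff\<close>,
  which is Schwartz, so its values on \<open>schwartz\<close> decide.\<close>

lemma has_zak_cong:
  assumes "dist_eq p q"
  shows "has_zak T p Z \<longleftrightarrow> has_zak T q Z"
proof -
  have "zak_term T p n \<Phi> = zak_term T q n \<Phi>" if "\<Phi> \<in> schwartz" for n \<Phi>
    using assms schwartz_shift[OF schwartz_zak_coeff[OF that]] unfolding zak_term_eq dist_eq_def by blast
  then show ?thesis
    by (simp add: has_zak_def dist_has_sum_def dist_scale_def)
qed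

section \<open>Uniqueness\<close>

text \<open>The integral is the characteristic function of the standard normal distribution.\<close>

lemma fourier_gauss:
  "(LINT x|lborel. exp (\<i> * of_real (t * x)) * of_real (std_normal_density x)) = of_real (exp (- t\<^sup>2 / 2))"
proof -
  have "(LINT x|lborel. exp (\<i> * of_real (t * x)) * of_real (std_normal_density x)) = char std_normal_distribution t"
    unfolding char_def
    by (subst integral_density) (auto simp: scaleR_conv_of_real mult.commute normal_density_nonneg)
  then show ?thesis by (simp add: char_std_normal_distribution)
qed

text \<open>Solving for the term \<open>n = 0\<close> bounds \<open>d 0\<close> by the sum of the
  others. Passing from \<open>s = 1\<close> to \<open>s\<^sup>2 = 1 + j\<close> multiplies each of
  them by at most \<open>exp (- c) ^ j\<close>, because \<open>n\<^sup>2 \<ge> 1\<close>, and the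
  sum at \<open>s = 1\<close> converges absolutely.\<close>

lemma has_sum_gauss_weights_imp_0:
  fixes d :: "int \<Rightarrow> complex"
  assumes c: "0 < c"
    and sums: "\<And>s. 0 < s \<Longrightarrow> ((\<lambda>n. of_real (exp (- (c * (of_int n * s)\<^sup>2))) * d n) has_sum 0) UNIV"
  shows "d 0 = 0"
proof -
  define w where "w = (\<lambda>s n. norm (of_real (exp (- (c * (of_int n * s)\<^sup>2))) * d n))"
  have w: "w s summable_on A" if "0 < s" for s A
  proof -
    have "(\<lambda>n. of_real (exp (- (c * (of_int n * s)\<^sup>2))) * d n) summable_on UNIV"
      using sums[OF that] by (auto simp: summable_on_def)
    then have "w s summable_on UNIV"
      unfolding w_def by (simp only: summable_on_iff_abs_summable_on_complex)
    then show ?thesis by (rule summable_on_subset) simp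
  qed
  define A where "A = (\<Sum>\<^sub>\<infinity>n\<in>UNIV - {0}. w 1 n)"
  have "norm (d 0) \<le> exp (- c) ^ j * A" for j :: nat
  proof -
    \<comment> \<open>With this choice \<open>(n * s)\<^sup>2 = n\<^sup>2 + j * n\<^sup>2\<close>,
      so the gain over \<open>s = 1\<close> is the clean geometric factor
      \<open>exp (- c) ^ j\<close>.\<close>
    define s where "s = sqrt (1 + real j)"
    define g where "g = (\<lambda>n. of_real (exp (- (c * (of_int n * s)\<^sup>2))) * d n)"
    have s: "0 < s" "s\<^sup>2 = 1 + real j" by (auto simp: s_def)
    have "g summable_on (UNIV - {0})"
      by (rule summable_on_subset[of _ UNIV]) (use sums[OF s(1)] in \<open>auto simp: g_def summable_on_def\<close>)
    then have "infsum g (insert 0 (UNIV - {0})) = g 0 + infsum g (UNIV - {0})"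
      by (rule infsum_insert) simp
    moreover have "insert 0 (UNIV - {0}) = (UNIV :: int set)" by auto
    moreover have "infsum g UNIV = 0"
      using infsumI[OF sums[OF s(1)]] by (simp add: g_def)
    ultimately have "d 0 = - infsum g (UNIV - {0})"
      by (simp add: g_def eq_neg_iff_add_eq_0)
    then have "norm (d 0) \<le> (\<Sum>\<^sub>\<infinity>n\<in>UNIV - {0}. w s n)"
      using norm_infsum_bound[of g "UNIV - {0}"] w[OF s(1)] by (simp add: w_def g_def)
    also have "\<dots> \<le> (\<Sum>\<^sub>\<infinity>n\<in>UNIV - {0}. exp (- c) ^ j * w 1 n)"
    proof (rule infsum_mono)
      fix n :: int assume "n \<in> UNIV - {0}"
      then have "1 \<le> \<bar>real_of_int n\<bar>" by auto
      then have "1 \<le> (real_of_int n)\<^sup>2" using abs_le_square_iff[of 1 "real_of_int n"] by simp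
      then have "real j * 1 \<le> real j * (real_of_int n)\<^sup>2" by (intro mult_left_mono) auto
      then have "real j + (of_int n)\<^sup>2 \<le> (of_int n * s)\<^sup>2"
        by (simp add: power_mult_distrib s algebra_simps)
      then have "c * (real j + (of_int n)\<^sup>2) \<le> c * (of_int n * s)\<^sup>2"
        using c by (intro mult_left_mono) auto
      then have "exp (- (c * (of_int n * s)\<^sup>2)) \<le> exp (- c) ^ j * exp (- (c * (of_int n)\<^sup>2))"
        by (simp add: algebra_simps flip: exp_of_nat_mult exp_add)
      from mult_right_mono[OF this, of "norm (d n)"] show "w s n \<le> exp (- c) ^ j * w 1 n"
        by (simp add: w_def norm_mult mult.assoc)
    qed (intro w summable_on_cmult_right s; simp)+
    also have "\<dots> = exp (- c) ^ j * A"
      by (simp add: A_def infsum_cmult_right')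
    finally show ?thesis .
  qed
  moreover have "(\<lambda>j. exp (- c) ^ j * A) \<longlonglongrightarrow> 0 * A"
    using c by (intro tendsto_intros LIMSEQ_realpow_zero) auto
  ultimately have "norm (d 0) \<le> 0 * A"
    by (intro LIMSEQ_le_const[of "\<lambda>j. exp (- c) ^ j * A"]) auto
  then show ?thesis by simp
qed

text \<open>Rescaling \<open>y\<close> by \<open>s\<close> leaves the transform of the standard
  normal density at \<open>- 2 * pi * n * s * T\<close>; half the square of this frequency is the
  exponent.\<close>

lemma zak_coeff_gauss:
  assumes s: "0 < s"
  shows "zak_coeff T (\<lambda>(x, y). \<phi> x * of_real (std_normal_density (y / s))) x n =
    of_real (s * exp (- (2 * (pi * T)\<^sup>2 * (of_int n * s)\<^sup>2))) * \<phi> x"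
proof -
  have "zak_coeff T (\<lambda>(x, y). \<phi> x * of_real (std_normal_density (y / s))) x n
      = s *\<^sub>R (LINT y|lborel. zak_char T n (0 + s * y) * (\<phi> x * of_real (std_normal_density ((0 + s * y) / s))))"
    unfolding zak_coeff_def prod.case using s
    by (subst lborel_integral_real_affine[where c=s and t=0]) simp_all
  also have "(\<lambda>y. zak_char T n (0 + s * y) * (\<phi> x * of_real (std_normal_density ((0 + s * y) / s))))
      = (\<lambda>y. \<phi> x * (exp (\<i> * of_real (- (2 * pi * of_int n * s * T) * y)) * of_real (std_normal_density y)))"
    using s by (simp add: zak_char_def mult_ac)
  also have "(LINT y|lborel. \<phi> x * (exp (\<i> * of_real (- (2 * pi * of_int n * s * T) * y)) * of_real (std_normal_density y)))
      = \<phi> x * of_real (exp (- (- (2 * pi * of_int n * s * T))\<^sup>2 / 2))"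
    by (simp only: integral_mult_right_zero fourier_gauss)
  also have "- (- (2 * pi * of_int n * s * T))\<^sup>2 / 2 = - (2 * (pi * T)\<^sup>2 * (of_int n * s)\<^sup>2)"
    by (simp add: power_mult_distrib)
  finally show ?thesis by (simp add: scaleR_conv_of_real mult_ac)
qed

lemma tempered_distribution_cmult:
  assumes "tempered_distribution u" "\<phi> \<in> schwartz"
  shows "u (\<lambda>x. c * \<phi> x) = c * u \<phi>"
  using assms by (simp add: tempered_distribution_def)

text \<open>For a tensor product with a Gaussian every \<open>zak_coeff\<close> is a number times
  \<open>\<phi>\<close>, so linearity pulls the Gaussian weight out of the distribution and leaves
  its values at translates of \<open>\<phi>\<close>, which do not depend on
  \<open>s\<close>.\<close>

lemma has_zak_unique:
  assumes T: "0 < T" and p: "tempered_distribution p" and q: "tempered_distribution q"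
    and Z: "has_zak T p Z" "has_zak T q Z"
  shows "dist_eq p q"
  unfolding dist_eq_def
proof
  fix \<phi> :: "real \<Rightarrow> complex" assume \<phi>: "\<phi> \<in> schwartz"
  define a where "a = (\<lambda>u :: real functional. \<lambda>n::int. u (\<lambda>t. \<phi> (t - of_int n * T)))"
  define E where "E = (\<lambda>s n. exp (- (2 * (pi * T)\<^sup>2 * (of_int n * s)\<^sup>2)))"
  have "((\<lambda>n. of_real (E s n) * (a p n - a q n)) has_sum 0) UNIV" if s: "0 < s" for s
  proof -
    define \<Phi> where "\<Phi> = (\<lambda>(x, y). \<phi> x * complex_of_real (std_normal_density (y / s)))"
    have "(\<lambda>y. complex_of_real (std_normal_density (y / s))) \<in> schwartz"
      using schwartz_gauss[of "1 / (2 * s\<^sup>2)" "1 / sqrt (2 * pi)"] s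
      by (simp add: std_normal_density_def power_divide mult.commute[of 2])
    then have \<Phi>: "\<Phi> \<in> schwartz"
      unfolding \<Phi>_def by (rule schwartz_tensor[OF \<phi>])
    have term_eq: "zak_term T u n \<Phi> = of_real (s * E s n) * a u n" if "tempered_distribution u" for u n
      unfolding zak_term_eq \<Phi>_def zak_coeff_gauss[OF s] E_def a_def
      by (rule tempered_distribution_cmult[OF that schwartz_shift[OF \<phi>]])
    have sums: "((\<lambda>n. of_real (sqrt T) * (of_real (s * E s n) * a u n)) has_sum Z \<Phi>) UNIV"
      if "tempered_distribution u" "has_zak T u Z" for u
      unfolding term_eq[OF that(1), symmetric]
      using that(2) \<Phi> by (simp add: has_zak_def dist_has_sum_def dist_scale_def)
    have minus: "((\<lambda>n. - (of_real (sqrt T) * (of_real (s * E s n) * a q n))) has_sum - Z \<Phi>) UNIV"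
      using sums[OF q Z(2)] by (simp only: has_sum_uminus minus_minus)
    have "((\<lambda>n. of_real (sqrt T) * (of_real (s * E s n) * a p n) - of_real (sqrt T) * (of_real (s * E s n) * a q n))
        has_sum Z \<Phi> - Z \<Phi>) UNIV"
      using has_sum_add[OF sums[OF p Z(1)] minus]
      by (simp only: diff_conv_add_uminus)
    \<comment> \<open>Dividing by the positive factor \<open>sqrt T * s\<close>, common to all
      terms, leaves the bare Gaussian weights.\<close>
    then have "((\<lambda>n. 1 / (of_real (sqrt T * s)) * (of_real (sqrt T) * (of_real (s * E s n) * a p n) - of_real (sqrt T) * (of_real (s * E s n) * a q n)))
        has_sum 1 / (of_real (sqrt T * s)) * (Z \<Phi> - Z \<Phi>)) UNIV"
      by (rule has_sum_cmult_right)
    then show ?thesis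
      using T s by (simp add: right_diff_distrib)
  qed
  from has_sum_gauss_weights_imp_0[of "2 * (pi * T)\<^sup>2" "\<lambda>n. a p n - a q n", OF _ this[unfolded E_def]] T
  show "p \<phi> = q \<phi>" by (simp add: a_def)
qed

text \<open>In the final equivalence, \<open>q = p\<close> says that the train has the lattice as
  its ZAK representation, and the forward direction says that it is the only such signal up to
  \<open>dist_eq\<close>.\<close>

theorem lemma1:
  fixes T \<Delta>f \<tau>\<^sub>0 \<nu>\<^sub>0 :: real
  assumes "T > 0" and "\<Delta>f = 1 / T"
    and "0 \<le> \<tau>\<^sub>0" and "\<tau>\<^sub>0 < T"
    and "0 \<le> \<nu>\<^sub>0" and "\<nu>\<^sub>0 < \<Delta>f"
  shows "\<exists>(Z :: (real \<times> real) functional) (p :: real functional).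
    tempered_distribution Z \<and>
    dist_has_sum
      (\<lambda>(m::int, n::int).
         dist_scale (exp (\<i> * of_real (2 * pi * \<nu>\<^sub>0 * of_int n * T)))
           (dist_tensor (dirac (\<tau>\<^sub>0 + of_int n * T)) (dirac (\<nu>\<^sub>0 + of_int m * \<Delta>f))))
      Z UNIV \<and>
    tempered_distribution p \<and>
    dist_has_sum
      (\<lambda>n::int.
         dist_scale (of_real (sqrt T))
           (dist_scale (exp (\<i> * of_real (2 * pi * \<nu>\<^sub>0 * of_int n * T)))
             (dirac (\<tau>\<^sub>0 + of_int n * T))))
      p UNIV \<and>
    (\<forall>q. tempered_distribution q \<longrightarrow> (has_zak T q Z \<longleftrightarrow> dist_eq q p))"
proof (intro exI conjI allI impI)
  let ?Z = "impulse_lattice T \<tau>\<^sub>0 \<nu>\<^sub>0" and ?p = "impulse_train T \<tau>\<^sub>0 \<nu>\<^sub>0"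
  note T = \<open>T > 0\<close>
  show "tempered_distribution ?Z" "tempered_distribution ?p"
    by (rule impulse_lattice[OF T] impulse_train[OF T])+
  \<comment> \<open>A tensor product of two point masses unfolds to the point mass at the
    pair.\<close>
  have "(\<lambda>(m::int, n::int).
         dist_scale (exp (\<i> * of_real (2 * pi * \<nu>\<^sub>0 * of_int n * T)))
           (dist_tensor (dirac (\<tau>\<^sub>0 + of_int n * T)) (dirac (\<nu>\<^sub>0 + of_int m * \<Delta>f))))
      = (\<lambda>i. dist_scale (phase T \<nu>\<^sub>0 (snd i)) (dirac (\<tau>\<^sub>0 + of_int (snd i) * T, \<nu>\<^sub>0 + of_int (fst i) / T)))"
    by (simp add: fun_eq_iff dist_scale_def dist_tensor_def dirac_def phase_def assms(2))
  then show "dist_has_sum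
      (\<lambda>(m::int, n::int).
         dist_scale (exp (\<i> * of_real (2 * pi * \<nu>\<^sub>0 * of_int n * T)))
           (dist_tensor (dirac (\<tau>\<^sub>0 + of_int n * T)) (dirac (\<nu>\<^sub>0 + of_int m * \<Delta>f))))
      ?Z UNIV"
    using impulse_lattice(2)[OF T] by simp
  show "dist_has_sum
      (\<lambda>n::int.
         dist_scale (of_real (sqrt T))
           (dist_scale (exp (\<i> * of_real (2 * pi * \<nu>\<^sub>0 * of_int n * T)))
             (dirac (\<tau>\<^sub>0 + of_int n * T))))
      ?p UNIV"
    using impulse_train(2)[OF T, of \<nu>\<^sub>0 \<tau>\<^sub>0] by (simp add: dist_scale_def phase_def mult.assoc)
  fix q :: "real functional" assume q: "tempered_distribution q"
  show "has_zak T q ?Z \<longleftrightarrow> dist_eq q ?p"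
    using has_zak_unique[OF T q impulse_train(1)[OF T] _ impulse_train_has_zak[OF T]]
      impulse_train_has_zak[OF T] has_zak_cong by blast
qed

end
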